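(* Let $k>1$ be a fixed integer, let $\theta>0$, and let $(\alpha,\beta)$ be an interval whose endpoints $\alpha$ and $\beta$ are irrational numbers that are linearly independent over $\mathbb{Q}$. For each $n$ equip $\mathfrak{S}_n$ with the Ewens distribution with parameter $\theta$, and let $$Y_{n,k} = \sum_{j=1}^n \frac{j^{k-1}\, C_j^{(n)}\,(\{j\alpha\}-\{j\beta\})}{n^{k-1}} .$$ Then $Y_{n,k}$ converges weakly, as $n\to\infty$, to some compactly supported limiting distribution $Y_{\infty,k}$. The moments of $Y_{\infty,k}$ are given implicitly by the following identity of formal power series in $z$: $$\sum_{m=0}^\infty \mathbb{E}\big[(Y_{\infty,k})^m\big]\,\frac{\Gamma(m(k-1)+\theta)}{\Gamma(\theta)\,m!}\,z^m=\exp(K(z)),$$ where $$K(z)=\sum_{m=1}^\infty \kappa_{2m}z^{2m},\qquad \kappa_{2m}=\frac{2\theta\,(2m(k-1)-1)!}{(2m+2)!}.$$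
   Context: $\{x\}$ is the fractional part of $x$; $\Gamma$ is the Gamma function. $\mathfrak{S}_n$ is the symmetric group on $\{1,\dots,n\}$. The Ewens distribution with parameter $\theta>0$ on $\mathfrak{S}_n$ is $\mathbb{P}(\sigma)=\theta^{c(\sigma)}/(\theta(\theta+1)\cdots(\theta+n-1))$, where $c(\sigma)$ is the total number of cycles of $\sigma$. $C_j^{(n)}(\sigma)$ is the number of cycles of $\sigma$ of length $j$.
   Formalization: The endpoints are assumed such that 1, α, β are linearly independent over ℚ, not only α and β; otherwise α = √2, β = 1+√2 gives {jα} = {jβ}, so Y_{n,k} = 0 although κ_2 > 0. *)

theory Defs
  imports
    "HOL-Probability.Probability"
    "HOL-Combinatorics.Orbits"
    "HOL-Computational_Algebra.Formal_Power_Series"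
begin

text \<open>
  The cycles of a permutation \<open>\<sigma>\<close> of \<open>{1..n}\<close>, each identified with its underlying set of points;
  fixed points count as cycles of length 1.
\<close>

definition perm_cycles :: "nat \<Rightarrow> (nat \<Rightarrow> nat) \<Rightarrow> nat set set" where
  "perm_cycles n \<sigma> = orbit \<sigma> ` {1..n}"

definition num_cycles :: "nat \<Rightarrow> (nat \<Rightarrow> nat) \<Rightarrow> nat" where
  "num_cycles n \<sigma> = card (perm_cycles n \<sigma>)"

definition num_cycles_of_length :: "nat \<Rightarrow> nat \<Rightarrow> (nat \<Rightarrow> nat) \<Rightarrow> nat" where
  "num_cycles_of_length n j \<sigma> = card {c \<in> perm_cycles n \<sigma>. card c = j}"

text \<open>Here \<open>pochhammer \<theta> n\<close> is the rising factorial \<open>\<theta> (\<theta> + 1) \<dots> (\<theta> + n - 1)\<close>.\<close>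

definition ewens :: "real \<Rightarrow> nat \<Rightarrow> (nat \<Rightarrow> nat) measure" where
  "ewens \<theta> n = point_measure {\<sigma>. \<sigma> permutes {1..n}}
     (\<lambda>\<sigma>. ennreal (\<theta> ^ num_cycles n \<sigma> / pochhammer \<theta> n))"

definition Y :: "nat \<Rightarrow> real \<Rightarrow> real \<Rightarrow> nat \<Rightarrow> (nat \<Rightarrow> nat) \<Rightarrow> real" where
  "Y k \<alpha> \<beta> n \<sigma> =
     (\<Sum>j=1..n. real j ^ (k - 1) * real (num_cycles_of_length n j \<sigma>) *
        (frac (real j * \<alpha>) - frac (real j * \<beta>)) / real n ^ (k - 1))"

text \<open>
  Linear independence in \<open>\<real>\<close> as a vector space over \<open>\<rat>\<close>. For the endpoints \<open>\<alpha>\<close>, \<open>\<beta>\<close> of the interval,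
  "irrational and linearly independent over \<open>\<rat>\<close>" is read in the sense usual for equidistribution
  modulo 1, namely that \<open>1\<close>, \<open>\<alpha>\<close>, \<open>\<beta>\<close> are linearly independent over \<open>\<rat>\<close>. Independence of \<open>\<alpha>\<close>
  and \<open>\<beta>\<close> alone would admit \<open>\<beta> = \<alpha> + 1\<close>, for which \<open>Y\<close> vanishes identically.
\<close>

definition rat_independent :: "real set \<Rightarrow> bool" where
  "rat_independent S \<longleftrightarrow> module.independent (\<lambda>(q::rat) (x::real). of_rat q * x) S"

text \<open>\<open>kappa k \<theta> m\<close> is the coefficient \<open>\<kappa>\<^sub>2\<^sub>m\<close> of \<open>z\<^sup>2\<^sup>m\<close> in \<open>K\<close>, to be used for \<open>m \<ge> 1\<close> only.\<close>

definition kappa :: "nat \<Rightarrow> real \<Rightarrow> nat \<Rightarrow> real" where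
  "kappa k \<theta> m = 2 * \<theta> * fact (2 * m * (k - 1) - 1) / fact (2 * m + 2)"

definition K :: "nat \<Rightarrow> real \<Rightarrow> real fps" where
  "K k \<theta> = Abs_fps (\<lambda>i. if even i \<and> i \<ge> 2 then kappa k \<theta> (i div 2) else 0)"

end

theory Submission
  imports Defs "HOL-Real_Asymp.Real_Asymp"
begin

text \<open>
  The proof is the method of moments. Write \<open>p = k - 1\<close> and \<open>a j = frac (j \<alpha>) - frac (j \<beta>)\<close>, so that
  \<open>n ^ p\<close> times \<open>Y\<close> is the sum \<open>W\<close> of \<open>g (card c)\<close> over the cycles \<open>c\<close>, where \<open>g j = j ^ p * a j\<close>.
  As the cycle lengths add up to \<open>n\<close>, the values of \<open>Y\<close> lie in \<open>[-1, 1]\<close>. On a fixed compact set,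
  convergence of all moments already yields a limiting distribution: compactness provides a
  subsequential limit, and the characteristic functions are controlled by the moments
  (\<open>method_of_moments_bounded\<close>).

  The moments satisfy a recursion. Multiplying by \<open>W\<close> amounts to marking a cycle; removing the marked
  cycle leaves a permutation of the remaining points, and there are \<open>(j - 1)!\<close> cycles on \<open>j\<close> given
  points. With \<open>A m n\<close> the sum of \<open>\<theta> ^ (number of cycles) * W ^ m\<close> over the permutations, divided by
  \<open>n!\<close>, this gives (\<open>ewens_sum_size_bias\<close>, \<open>ewens_sum_power_Suc\<close>)
  \<open>A (m+1) n = \<theta> * \<Sum>i\<le>m. (m choose i) * \<Sum>j=1..n. j ^ (p (i+1) - 1) * a j ^ (i+1) * A (m-i) (n-j)\<close>.

  Now the arithmetic enters, and only through the Cesaro means of the powers of \<open>a\<close>. Since \<open>1\<close>, \<open>\<alpha>\<close>, \<open>\<beta>\<close> are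
  independent over the rationals, the points \<open>(j \<alpha>, j \<beta>)\<close> are equidistributed modulo 1, so the mean of
  \<open>a j ^ q\<close> is \<open>E (U - V) ^ q = (1 + (-1) ^ q) / ((q+1) (q+2))\<close> for independent uniform \<open>U\<close> and \<open>V\<close>
  (\<open>average_frac_diff_power\<close>). In each convolution of the recursion the oscillating factor may be
  replaced by its mean (\<open>cesaro_convolution\<close>). What remains is a convolution of coefficients of powers
  of \<open>1 / (1 - u)\<close>, whose exponents simply add up. By induction \<open>A m n\<close> is asymptotic to \<open>c m\<close> times the
  coefficient of \<open>u ^ n\<close> in \<open>(1 - u) powr - (\<theta> + m p)\<close>, with a recursion for \<open>c\<close> that is the power series
  identity \<open>F' = K' * F\<close> for \<open>F = exp K\<close>, read off coefficient by coefficient. Dividing by the total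
  Ewens mass, which is the same coefficient for \<open>m = 0\<close>, and by \<open>n ^ (m p)\<close>, produces the quotient of
  Gamma values in the statement.
\<close>

section \<open>Coefficients of powers of the geometric series\<close>

text \<open>
  The coefficient of \<open>u ^ n\<close> in \<open>(1 - u) powr - \<gamma>\<close>. It serves as the scale for all asymptotics below,
  in place of the equivalent \<open>n powr (\<gamma> - 1)\<close>, because convolution adds up the exponents exactly.
\<close>
definition rising_coeff :: "real \<Rightarrow> nat \<Rightarrow> real" where
  "rising_coeff \<gamma> n = pochhammer \<gamma> n / fact n"

lemma rising_coeff_pos: "\<gamma> > 0 \<Longrightarrow> rising_coeff \<gamma> n > 0"
  by (simp add: rising_coeff_def pochhammer_pos)

lemma rising_coeff_1 [simp]: "rising_coeff 1 n = 1"
  by (simp add: rising_coeff_def pochhammer_fact [symmetric])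

lemma rising_coeff_Suc: "rising_coeff \<gamma> (Suc n) * (real n + 1) = rising_coeff \<gamma> n * (\<gamma> + real n)"
  by (simp add: rising_coeff_def pochhammer_Suc divide_simps)

lemma rising_coeff_convolution:
  "(\<Sum>j\<le>n. rising_coeff s j * rising_coeff \<gamma> (n - j)) = rising_coeff (s + \<gamma>) n"
proof -
  have "rising_coeff (s + \<gamma>) n
      = (\<Sum>j\<le>n. real (n choose j) * pochhammer s j * pochhammer \<gamma> (n - j)) / fact n"
    by (simp add: rising_coeff_def pochhammer_binomial_sum)
  also have "\<dots> = (\<Sum>j\<le>n. rising_coeff s j * rising_coeff \<gamma> (n - j))"
    unfolding sum_divide_distrib
    by (intro sum.cong refl) (simp add: rising_coeff_def binomial_fact)
  finally show ?thesis by simp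
qed

lemma sum_rising_coeff: "(\<Sum>j\<le>n. rising_coeff \<gamma> j) = rising_coeff (\<gamma> + 1) n"
  using rising_coeff_convolution[where s = \<gamma> and \<gamma> = 1 and n = n] by simp

text \<open>
  Differentiating \<open>(1 - u) powr - \<gamma>\<close> multiplies it by \<open>\<gamma> / (1 - u)\<close>. This recursion determines
  the coefficients, and it is how the total Ewens mass will be recognised.
\<close>
lemma rising_coeff_size_bias: "real n * rising_coeff \<gamma> n = \<gamma> * (\<Sum>l<n. rising_coeff \<gamma> l)"
proof (cases n)
  case (Suc m)
  have "real n * rising_coeff \<gamma> n = \<gamma> * rising_coeff (\<gamma> + 1) m"
    by (simp add: Suc rising_coeff_def pochhammer_rec divide_simps add.commute)
  then show ?thesis
    unfolding Suc lessThan_Suc_atMost sum_rising_coeff .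
qed simp

lemma rising_coeff_mono:
  assumes "\<gamma> \<ge> 1" "m \<le> n"
  shows "rising_coeff \<gamma> m \<le> rising_coeff \<gamma> n"
proof (rule lift_Suc_mono_le[OF _ assms(2)])
  fix l
  have "rising_coeff \<gamma> l * (real l + 1) \<le> rising_coeff \<gamma> l * (\<gamma> + real l)"
    using assms by (intro mult_left_mono less_imp_le[OF rising_coeff_pos]) auto
  then show "rising_coeff \<gamma> l \<le> rising_coeff \<gamma> (Suc l)"
    by (simp flip: rising_coeff_Suc)
qed

lemma rising_coeff_antimono:
  assumes "\<gamma> > 0" "\<gamma> \<le> 1" "m \<le> n"
  shows "rising_coeff \<gamma> n \<le> rising_coeff \<gamma> m"
proof (rule lift_Suc_antimono_le[OF _ assms(3)])
  fix l
  have "rising_coeff \<gamma> l * (\<gamma> + real l) \<le> rising_coeff \<gamma> l * (real l + 1)"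
    using assms by (intro mult_left_mono less_imp_le[OF rising_coeff_pos]) auto
  then show "rising_coeff \<gamma> (Suc l) \<le> rising_coeff \<gamma> l"
    by (simp flip: rising_coeff_Suc)
qed

lemma rising_coeff_asymp:
  assumes "\<gamma> > 0"
  shows "(\<lambda>n. rising_coeff \<gamma> n / (real n + 1) powr (\<gamma> - 1)) \<longlonglongrightarrow> 1 / Gamma \<gamma>"
proof -
  have 1: "(\<lambda>n. real n powr \<gamma> / ((\<gamma> + real n) * (real n + 1) powr (\<gamma> - 1))) \<longlonglongrightarrow> 1"
    by real_asymp
  have "(\<lambda>n. real n powr \<gamma> / ((\<gamma> + real n) * (real n + 1) powr (\<gamma> - 1)) / Gamma_series \<gamma> n)
          \<longlonglongrightarrow> 1 / Gamma \<gamma>"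
    using Gamma_real_pos[OF assms] by (intro tendsto_divide 1 Gamma_series_LIMSEQ) auto
  then show ?thesis
  proof (rule Lim_transform_eventually)
    show "\<forall>\<^sub>F n in sequentially. real n powr \<gamma> / ((\<gamma> + real n) * (real n + 1) powr (\<gamma> - 1)) / Gamma_series \<gamma> n
        = rising_coeff \<gamma> n / (real n + 1) powr (\<gamma> - 1)"
      using eventually_gt_at_top[of 0]
    proof eventually_elim
      case (elim n)
      then show ?case using assms pochhammer_pos[OF assms, of n]
        by (simp add: Gamma_series_def rising_coeff_def pochhammer_Suc powr_def divide_simps)
    qed
  qed
qed

lemma rising_coeff_bounds:
  assumes "\<gamma> > 0"
  obtains c C where "c > 0" "C > 0"
    "\<And>n. c * (real n + 1) powr (\<gamma> - 1) \<le> rising_coeff \<gamma> n"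
    "\<And>n. rising_coeff \<gamma> n \<le> C * (real n + 1) powr (\<gamma> - 1)"
proof -
  define f where "f n = rising_coeff \<gamma> n / (real n + 1) powr (\<gamma> - 1)" for n
  have fpos: "f n > 0" for n using rising_coeff_pos[OF assms] by (simp add: f_def)
  have lim: "f \<longlonglongrightarrow> 1 / Gamma \<gamma>" unfolding f_def by (rule rising_coeff_asymp[OF assms])
  have "(\<lambda>n. inverse (f n)) \<longlonglongrightarrow> inverse (1 / Gamma \<gamma>)"
    using Gamma_real_pos[OF assms] by (intro tendsto_inverse lim) auto
  then have "Bseq f" "Bseq (\<lambda>n. inverse (f n))" using lim
    by (auto intro!: convergent_imp_Bseq convergentI)
  then obtain A B where AB: "A > 0" "\<And>n. \<bar>f n\<bar> \<le> A" "B > 0" "\<And>n. \<bar>inverse (f n)\<bar> \<le> B"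
    unfolding Bseq_def by auto
  show thesis
  proof
    show "1 / B > 0" "A > 0" using AB by auto
    show "rising_coeff \<gamma> n \<le> A * (real n + 1) powr (\<gamma> - 1)" for n
      using AB(2)[of n] fpos[of n] by (simp add: f_def divide_simps)
    show "1 / B * (real n + 1) powr (\<gamma> - 1) \<le> rising_coeff \<gamma> n" for n
    proof -
      have "1 \<le> B * f n" using AB(4)[of n] fpos[of n] by (simp add: field_simps)
      then show ?thesis using AB(3) by (simp add: f_def field_simps)
    qed
  qed
qed

lemma rising_coeff_smallo:
  assumes "0 < \<gamma>" "\<gamma> < \<delta>"
  shows "rising_coeff \<gamma> \<in> o(rising_coeff \<delta>)"
proof -
  have "\<delta> > 0" using assms by simp
  obtain c0 C where "c0 > 0" "C > 0"
    and "\<And>n. c0 * (real n + 1) powr (\<gamma> - 1) \<le> rising_coeff \<gamma> n"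
    and C: "\<And>n. rising_coeff \<gamma> n \<le> C * (real n + 1) powr (\<gamma> - 1)"
    by (rule rising_coeff_bounds[OF assms(1)]) blast
  obtain c C0 where c: "c > 0" and "C0 > 0"
    and c': "\<And>n. c * (real n + 1) powr (\<delta> - 1) \<le> rising_coeff \<delta> n"
    and "\<And>n. rising_coeff \<delta> n \<le> C0 * (real n + 1) powr (\<delta> - 1)"
    by (rule rising_coeff_bounds[OF \<open>\<delta> > 0\<close>]) blast
  have "rising_coeff \<gamma> \<in> O(\<lambda>n. (real n + 1) powr (\<gamma> - 1))"
    using C rising_coeff_pos[OF assms(1)] by (intro bigoI[where c=C]) (auto simp: abs_of_pos)
  also have "(\<lambda>n. (real n + 1) powr (\<gamma> - 1)) \<in> o(\<lambda>n. (real n + 1) powr (\<delta> - 1))"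
    using assms by real_asymp
  also have "(\<lambda>n. (real n + 1) powr (\<delta> - 1)) \<in> O(rising_coeff \<delta>)"
    using c c' rising_coeff_pos[of \<delta>] assms
    by (intro bigoI[where c="1/c"]) (auto simp: abs_of_pos field_simps)
  finally show ?thesis .
qed

text \<open>
  Along the natural numbers only finitely many terms escape an asymptotic bound, and they can be
  absorbed into the constant. A convolution involves all terms, so it needs the bound everywhere.
\<close>
lemma bigo_nat_uniform:
  fixes f g :: "nat \<Rightarrow> real"
  assumes "f \<in> O(g)" "\<And>n. g n > 0"
  obtains C where "C > 0" "\<And>n. \<bar>f n\<bar> \<le> C * g n"
proof -
  obtain c where c: "c > 0" "\<forall>\<^sub>F n in sequentially. \<bar>f n\<bar> \<le> c * g n"
    using landau_o.bigE[OF assms(1)] assms(2) by (auto simp: abs_of_pos)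
  then obtain N where N: "\<And>n. n \<ge> N \<Longrightarrow> \<bar>f n\<bar> \<le> c * g n"
    by (auto simp: eventually_sequentially)
  define C where "C = c + (\<Sum>i<N. \<bar>f i\<bar> / g i)"
  have nn: "\<bar>f i\<bar> / g i \<ge> 0" for i using assms(2)[of i] by auto
  have *: "\<bar>f n\<bar> \<le> C * g n" for n
  proof (cases "n < N")
    case True
    then have "\<bar>f n\<bar> / g n \<le> (\<Sum>i<N. \<bar>f i\<bar> / g i)"
      by (intro member_le_sum) (auto intro: nn)
    also have "\<dots> \<le> C" using c by (simp add: C_def)
    finally show ?thesis using assms(2)[of n] by (simp add: field_simps)
  next
    case False
    have "c * g n \<le> C * g n" using assms(2)[of n] nn
      by (intro mult_right_mono) (auto simp: C_def less_imp_le intro!: sum_nonneg)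
    then show ?thesis using N[of n] False by auto
  qed
  have "C > 0" using c nn by (auto simp: C_def intro!: add_pos_nonneg sum_nonneg)
  then show thesis using * by (rule that)
qed

text \<open>
  The terms of \<open>u\<close> beyond some index are at most \<open>\<eta>\<close> times the scale. The finitely many others are
  dominated by a multiple of the scale with exponent \<open>\<gamma> / 2\<close>, and a smaller exponent contributes a
  lower order after convolution.
\<close>
lemma convolution_smallo:
  assumes "s > 0" "\<gamma> > 0" and x: "x \<in> O(rising_coeff s)" and u: "u \<in> o(rising_coeff \<gamma>)"
  shows "(\<lambda>n. \<Sum>j\<le>n. x j * u (n - j)) \<in> o(rising_coeff (s + \<gamma>))"
proof (rule landau_o.smallI)
  fix \<epsilon> :: real assume "\<epsilon> > 0"
  obtain C where C: "C > 0" "\<And>j. \<bar>x j\<bar> \<le> C * rising_coeff s j"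
    by (rule bigo_nat_uniform[OF x rising_coeff_pos[OF \<open>s > 0\<close>]]) blast
  define \<eta> where "\<eta> = \<epsilon> / (2 * C)"
  have "\<eta> > 0" using \<open>\<epsilon> > 0\<close> C by (simp add: \<eta>_def)
  then obtain N where N: "\<And>l. l \<ge> N \<Longrightarrow> \<bar>u l\<bar> \<le> \<eta> * rising_coeff \<gamma> l"
    using landau_o.smallD[OF u \<open>\<eta> > 0\<close>] rising_coeff_pos[OF \<open>\<gamma> > 0\<close>]
    by (auto simp: eventually_sequentially abs_of_pos)
  define g where "g = rising_coeff (\<gamma> / 2)"
  have gpos: "g l > 0" for l unfolding g_def using assms by (intro rising_coeff_pos) auto
  define v where "v l = (if l < N then u l else 0)" for l
  have "\<forall>\<^sub>F l in sequentially. norm (v l) \<le> 1 * norm (g l)"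
    using eventually_ge_at_top[of N] by eventually_elim (simp add: v_def)
  then have "v \<in> O(g)" by (rule bigoI)
  then obtain B where B: "B > 0" "\<And>l. \<bar>v l\<bar> \<le> B * g l"
    using gpos by (rule bigo_nat_uniform) blast
  have ub: "\<bar>u l\<bar> \<le> \<eta> * rising_coeff \<gamma> l + B * g l" for l
  proof (cases "l < N")
    case True
    have "0 \<le> \<eta> * rising_coeff \<gamma> l"
      using \<open>\<eta> > 0\<close> rising_coeff_pos[OF \<open>\<gamma> > 0\<close>, of l] by simp
    with True B(2)[of l] show ?thesis by (simp add: v_def)
  next
    case False
    have "0 \<le> B * g l" using B(1) gpos[of l] by simp
    with False N[of l] show ?thesis by simp
  qed
  have bound: "\<bar>\<Sum>j\<le>n. x j * u (n - j)\<bar>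
        \<le> C * \<eta> * rising_coeff (s + \<gamma>) n + C * B * rising_coeff (s + \<gamma> / 2) n" for n
  proof -
    have "\<bar>\<Sum>j\<le>n. x j * u (n - j)\<bar> \<le> (\<Sum>j\<le>n. \<bar>x j\<bar> * \<bar>u (n - j)\<bar>)"
      by (rule order_trans[OF sum_abs]) (simp add: abs_mult)
    also have "\<dots> \<le> (\<Sum>j\<le>n. (C * rising_coeff s j) *
                        (\<eta> * rising_coeff \<gamma> (n - j) + B * g (n - j)))"
      using C rising_coeff_pos[OF \<open>s > 0\<close>]
      by (intro sum_mono mult_mono ub) (auto intro!: mult_nonneg_nonneg simp: less_imp_le)
    also have "\<dots> = C * \<eta> * (\<Sum>j\<le>n. rising_coeff s j * rising_coeff \<gamma> (n - j)) +
                     C * B * (\<Sum>j\<le>n. rising_coeff s j * g (n - j))"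
      by (simp add: sum_distrib_left sum.distrib [symmetric] algebra_simps)
    also have "\<dots> = C * \<eta> * rising_coeff (s + \<gamma>) n + C * B * rising_coeff (s + \<gamma> / 2) n"
      by (simp add: g_def rising_coeff_convolution)
    finally show ?thesis .
  qed
  have "rising_coeff (s + \<gamma> / 2) \<in> o(rising_coeff (s + \<gamma>))"
    using assms by (intro rising_coeff_smallo) auto
  from landau_o.smallD[OF this, of "\<epsilon> / (2 * C * B)"]
  have "\<forall>\<^sub>F n in sequentially. norm (rising_coeff (s + \<gamma> / 2) n)
      \<le> \<epsilon> / (2 * C * B) * norm (rising_coeff (s + \<gamma>) n)"
    using \<open>\<epsilon> > 0\<close> C B by simp
  then show "\<forall>\<^sub>F n in sequentially. norm (\<Sum>j\<le>n. x j * u (n - j)) \<le> \<epsilon> * norm (rising_coeff (s + \<gamma>) n)"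
  proof eventually_elim
    case (elim n)
    have p: "rising_coeff (s + \<gamma>) n > 0" "rising_coeff (s + \<gamma> / 2) n > 0"
      using assms by (auto intro!: rising_coeff_pos)
    have "C * B * rising_coeff (s + \<gamma> / 2) n \<le> \<epsilon> / 2 * rising_coeff (s + \<gamma>) n"
      using elim p C B by (simp add: abs_of_pos field_simps)
    moreover have "C * \<eta> * rising_coeff (s + \<gamma>) n = \<epsilon> / 2 * rising_coeff (s + \<gamma>) n"
      using C by (simp add: \<eta>_def)
    ultimately have "\<bar>\<Sum>j\<le>n. x j * u (n - j)\<bar> \<le> \<epsilon> * rising_coeff (s + \<gamma>) n"
      using bound[of n] by linarith
    then show ?case using p by simp
  qed
qed

section \<open>Convolution with a sequence that has a Cesaro mean\<close>

text \<open>
  Summation by parts leaves the total variation of \<open>v\<close>, which telescopes as \<open>v\<close> is monotone.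
\<close>
lemma abel_summation_bound:
  fixes x v :: "nat \<Rightarrow> real"
  assumes mono: "mono_on {..n} v \<or> antimono_on {..n} v"
    and v: "\<And>j. j \<le> n \<Longrightarrow> 0 \<le> v j \<and> v j \<le> V"
    and X: "\<And>m. m \<le> n \<Longrightarrow> \<bar>\<Sum>j\<le>m. x j\<bar> \<le> S"
  shows "\<bar>\<Sum>j\<le>n. x j * v j\<bar> \<le> 2 * S * V"
proof -
  define X where "X m = (\<Sum>j\<le>m. x j)" for m
  have parts: "(\<Sum>j\<le>m. x j * v j) = X m * v m - (\<Sum>j<m. X j * (v (Suc j) - v j))" for m
    by (induction m) (auto simp: X_def algebra_simps)
  have S: "S \<ge> 0" using X[of 0] by auto
  have tele: "(\<Sum>j<n. \<bar>v (Suc j) - v j\<bar>) = \<bar>v n - v 0\<bar>"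
    using mono
  proof
    assume m: "mono_on {..n} v"
    have le: "v i \<le> v j" if "i \<le> j" "j \<le> n" for i j
      using mono_onD[OF m, of i j] that by simp
    have "(\<Sum>j<n. \<bar>v (Suc j) - v j\<bar>) = (\<Sum>j<n. v (Suc j) - v j)"
      by (intro sum.cong refl) (simp add: le)
    also have "\<dots> = v n - v 0" by (rule sum_lessThan_telescope)
    finally show ?thesis using le[of 0 n] by simp
  next
    assume m: "antimono_on {..n} v"
    have le: "v j \<le> v i" if "i \<le> j" "j \<le> n" for i j
      using monotone_onD[OF m, of i j] that by simp
    have "(\<Sum>j<n. \<bar>v (Suc j) - v j\<bar>) = (\<Sum>j<n. v j - v (Suc j))"
      by (intro sum.cong refl) (simp add: le)
    also have "\<dots> = v 0 - v n" by (rule sum_lessThan_telescope')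
    finally show ?thesis using le[of 0 n] by simp
  qed
  have "\<bar>\<Sum>j\<le>n. x j * v j\<bar> \<le> \<bar>X n * v n\<bar> + \<bar>\<Sum>j<n. X j * (v (Suc j) - v j)\<bar>"
    unfolding parts by (rule abs_triangle_ineq4)
  also have "\<bar>\<Sum>j<n. X j * (v (Suc j) - v j)\<bar> \<le> (\<Sum>j<n. S * \<bar>v (Suc j) - v j\<bar>)"
    by (rule order_trans[OF sum_abs])
      (auto simp: abs_mult X_def intro!: sum_mono mult_right_mono X)
  also have "\<dots> = S * \<bar>v n - v 0\<bar>" by (simp add: tele flip: sum_distrib_left)
  also have "\<bar>X n * v n\<bar> \<le> S * v n"
    using v[of n] X[of n] by (auto simp: abs_mult X_def intro!: mult_right_mono)
  also have "S * v n + S * \<bar>v n - v 0\<bar> = S * (v n + \<bar>v n - v 0\<bar>)" by (simp add: algebra_simps)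
  also have "\<dots> \<le> S * (2 * V)"
    using v[of n] v[of 0] S by (intro mult_left_mono) auto
  finally show ?thesis by simp
qed


lemma weighted_partial_sum_bound:
  assumes "s \<ge> 1" and D: "\<And>m. \<bar>\<Sum>j\<le>m. b j\<bar> \<le> \<epsilon> * (real m + 1) + C" and "\<epsilon> \<ge> 0" and "m \<le> n"
  shows "\<bar>\<Sum>j\<le>m. b j * rising_coeff s j\<bar> \<le> 2 * (\<epsilon> * (real n + 1) + C) * rising_coeff s n"
proof (rule abel_summation_bound[where S = "\<epsilon> * (real n + 1) + C" and V = "rising_coeff s n"])
  show "mono_on {..m} (rising_coeff s) \<or> antimono_on {..m} (rising_coeff s)"
    using assms(1) by (intro disjI1 mono_onI rising_coeff_mono)
  show "0 \<le> rising_coeff s j \<and> rising_coeff s j \<le> rising_coeff s n" if "j \<le> m" for j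
    using that assms by (auto intro!: rising_coeff_mono less_imp_le[OF rising_coeff_pos])
  show "\<bar>\<Sum>j\<le>i. b j\<bar> \<le> \<epsilon> * (real n + 1) + C" if "i \<le> m" for i
  proof -
    have "\<epsilon> * (real i + 1) \<le> \<epsilon> * (real n + 1)"
      using that assms by (intro mult_left_mono) auto
    then show ?thesis using D[of i] by linarith
  qed
qed

text \<open>
  Oscillation of \<open>b\<close> kills the convolution. Summation by parts against the increasing weight
  \<open>rising_coeff s\<close> shows that the partial sums of \<open>b j * rising_coeff s j\<close> are negligible, and a second
  summation by parts brings in \<open>rising_coeff \<gamma> (n - j)\<close>. If \<open>\<gamma> < 1\<close>, that factor is largest at \<open>j = n\<close>,
  where it is too big for this argument: it is \<open>1\<close> there and not of order \<open>n powr (\<gamma> - 1)\<close>. Therefore it is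
  truncated for the last \<open>n / d\<close> indices. The part cut off is bounded without any cancellation by a
  multiple of \<open>d powr - \<gamma>\<close> on the scale of the claim, which is small for large \<open>d\<close>.
\<close>
lemma cesaro_null_convolution:
  fixes b :: "nat \<Rightarrow> real"
  assumes s: "s \<ge> 1" and \<gamma>: "\<gamma> > 0" and b: "\<And>j. \<bar>b j\<bar> \<le> B"
    and D: "(\<lambda>n. \<Sum>j\<le>n. b j) \<in> o(\<lambda>n. real n + 1)"
  shows "(\<lambda>n. \<Sum>j\<le>n. b j * rising_coeff s j * rising_coeff \<gamma> (n - j)) \<in> o(rising_coeff (s + \<gamma>))"
    (is "?T \<in> _")
proof -
  have "s > 0" "\<gamma> + 1 > 0" "s + \<gamma> > 0" using s \<gamma> by auto
  obtain cs Cs where Cs: "cs > 0" "Cs > 0" "\<And>n. cs * (real n + 1) powr (s - 1) \<le> rising_coeff s n"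
      "\<And>n. rising_coeff s n \<le> Cs * (real n + 1) powr (s - 1)"
    by (rule rising_coeff_bounds[OF \<open>s > 0\<close>]) blast
  obtain cg Cg where Cg: "cg > 0" "Cg > 0" "\<And>n. cg * (real n + 1) powr (\<gamma> - 1) \<le> rising_coeff \<gamma> n"
      "\<And>n. rising_coeff \<gamma> n \<le> Cg * (real n + 1) powr (\<gamma> - 1)"
    by (rule rising_coeff_bounds[OF \<gamma>]) blast
  obtain c1 C1 where C1: "c1 > 0" "C1 > 0"
      "\<And>n. c1 * (real n + 1) powr (\<gamma> + 1 - 1) \<le> rising_coeff (\<gamma> + 1) n"
      "\<And>n. rising_coeff (\<gamma> + 1) n \<le> C1 * (real n + 1) powr (\<gamma> + 1 - 1)"
    by (rule rising_coeff_bounds[OF \<open>\<gamma> + 1 > 0\<close>]) blast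
  obtain c2 C2 where C2: "c2 > 0" "C2 > 0"
      "\<And>n. c2 * (real n + 1) powr (s + \<gamma> - 1) \<le> rising_coeff (s + \<gamma>) n"
      "\<And>n. rising_coeff (s + \<gamma>) n \<le> C2 * (real n + 1) powr (s + \<gamma> - 1)"
    by (rule rising_coeff_bounds[OF \<open>s + \<gamma> > 0\<close>]) blast
  have B: "B \<ge> 0" using b[of 0] by auto
  have partial: "\<exists>C\<ge>0. \<forall>m. \<bar>\<Sum>j\<le>m. b j\<bar> \<le> \<epsilon> * (real m + 1) + C" if "\<epsilon> > 0" for \<epsilon>
  proof -
    obtain N where N: "\<And>n. n \<ge> N \<Longrightarrow> \<bar>\<Sum>j\<le>n. b j\<bar> \<le> \<epsilon> * (real n + 1)"
      using landau_o.smallD[OF D \<open>\<epsilon> > 0\<close>] by (auto simp: eventually_sequentially)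
    define C where "C = (\<Sum>i<N. \<bar>\<Sum>j\<le>i. b j\<bar>)"
    have "C \<ge> 0" by (simp add: C_def sum_nonneg)
    moreover have "\<bar>\<Sum>j\<le>m. b j\<bar> \<le> \<epsilon> * (real m + 1) + C" for m
    proof (cases "m < N")
      case True
      then have "\<bar>\<Sum>j\<le>m. b j\<bar> \<le> C"
        unfolding C_def by (intro member_le_sum[where f = "\<lambda>i. \<bar>\<Sum>j\<le>i. b j\<bar>"]) auto
      moreover have "\<epsilon> * (real m + 1) \<ge> 0" using that by simp
      ultimately show ?thesis by linarith
    next
      case False
      then show ?thesis using N[of m] \<open>C \<ge> 0\<close> by simp
    qed
    ultimately show ?thesis by blast
  qed
  have reduce: "?T \<in> o(rising_coeff (s + \<gamma>))"
    if *: "\<And>e. e > 0 \<Longrightarrow> \<exists>A. \<forall>n. \<bar>?T n\<bar> \<le> (e + A / (real n + 1)) * (real n + 1) powr (s + \<gamma> - 1)"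
  proof -
    have "?T \<in> o(\<lambda>n. (real n + 1) powr (s + \<gamma> - 1))"
    proof (rule landau_o.smallI)
      fix e :: real assume "e > 0"
      obtain A where A: "\<And>n. \<bar>?T n\<bar> \<le> (e / 2 + A / (real n + 1)) * (real n + 1) powr (s + \<gamma> - 1)"
        using *[of "e / 2"] \<open>e > 0\<close> by auto
      have "(\<lambda>n. A / (real n + 1)) \<longlonglongrightarrow> 0" by real_asymp
      then have "\<forall>\<^sub>F n in sequentially. A / (real n + 1) < e / 2"
        using \<open>e > 0\<close> by (intro order_tendstoD) auto
      then show "\<forall>\<^sub>F n in sequentially. norm (?T n) \<le> e * norm ((real n + 1) powr (s + \<gamma> - 1))"
      proof eventually_elim
        case (elim n)
        have "(e / 2 + A / (real n + 1)) * (real n + 1) powr (s + \<gamma> - 1) \<le> e * (real n + 1) powr (s + \<gamma> - 1)"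
          using elim by (intro mult_right_mono) (linarith, simp)
        from order_trans[OF A[of n] this] show ?case by simp
      qed
    qed
    also have "(\<lambda>n. (real n + 1) powr (s + \<gamma> - 1)) \<in> O(rising_coeff (s + \<gamma>))"
      using C2(1,3) rising_coeff_pos[OF \<open>s + \<gamma> > 0\<close>]
      by (intro bigoI[where c="1/c2"]) (auto simp: abs_of_pos field_simps)
    finally show ?thesis .
  qed
  show ?thesis
  proof (cases "\<gamma> \<ge> 1")
    case True
    show ?thesis
    proof (rule reduce)
      fix e :: real assume "e > 0"
      define \<epsilon> where "\<epsilon> = e / (4 * Cs * Cg)"
      have "\<epsilon> > 0" using Cs Cg \<open>e > 0\<close> by (simp add: \<epsilon>_def)
      from partial[OF this] obtain C where "C \<ge> 0"
        and C: "\<And>m. \<bar>\<Sum>j\<le>m. b j\<bar> \<le> \<epsilon> * (real m + 1) + C" by blast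
      have "\<bar>?T n\<bar> \<le> (e + 4 * C * Cs * Cg / (real n + 1)) * (real n + 1) powr (s + \<gamma> - 1)" for n
      proof -
        define r where "r = real n + 1"
        have r: "r > 0" by (simp add: r_def)
        have "\<bar>?T n\<bar> \<le> 2 * (2 * (\<epsilon> * r + C) * rising_coeff s n) * rising_coeff \<gamma> n"
          unfolding r_def
        proof (rule abel_summation_bound)
          show "mono_on {..n} (\<lambda>j. rising_coeff \<gamma> (n - j)) \<or> antimono_on {..n} (\<lambda>j. rising_coeff \<gamma> (n - j))"
            using True by (intro disjI2 monotone_onI rising_coeff_mono) auto
          show "0 \<le> rising_coeff \<gamma> (n - j) \<and> rising_coeff \<gamma> (n - j) \<le> rising_coeff \<gamma> n" for j
            using True \<gamma> by (auto intro!: rising_coeff_mono less_imp_le[OF rising_coeff_pos])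
          show "\<bar>\<Sum>j\<le>m. b j * rising_coeff s j\<bar> \<le> 2 * (\<epsilon> * (real n + 1) + C) * rising_coeff s n"
            if "m \<le> n" for m
            using s C \<open>\<epsilon> > 0\<close> that by (intro weighted_partial_sum_bound) auto
        qed
        also have "\<dots> \<le> 2 * (2 * (\<epsilon> * r + C) * (Cs * r powr (s - 1))) * (Cg * r powr (\<gamma> - 1))"
          using Cs(2,4) Cg(2,4) \<open>\<epsilon> > 0\<close> \<open>C \<ge> 0\<close> r rising_coeff_pos[OF \<open>s > 0\<close>, of n] rising_coeff_pos[OF \<gamma>, of n]
          by (intro mult_mono mult_left_mono) (auto simp: r_def)
        also have "\<dots> = 4 * Cs * Cg * (\<epsilon> + C / r) * (r * r powr (s - 1) * r powr (\<gamma> - 1))"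
          using r by (simp add: field_simps)
        also have "r * r powr (s - 1) * r powr (\<gamma> - 1) = r powr (s + \<gamma> - 1)"
          using r by (simp add: powr_mult_base add_diff_eq flip: powr_add)
        also have "4 * Cs * Cg * (\<epsilon> + C / r) = e + 4 * C * Cs * Cg / r"
          using Cs(2) Cg(2) r by (simp add: \<epsilon>_def field_simps)
        finally show ?thesis by (simp add: r_def)
      qed
      then show "\<exists>A. \<forall>n. \<bar>?T n\<bar> \<le> (e + A / (real n + 1)) * (real n + 1) powr (s + \<gamma> - 1)" by blast
    qed
  next
    case False
    show ?thesis
    proof (rule reduce)
      fix e :: real assume "e > 0"
      have "(\<lambda>d. B * Cs * C1 * (1 / (real d + 1)) powr \<gamma>) \<longlonglongrightarrow> 0"
        using \<gamma> by real_asymp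
      then have "\<forall>\<^sub>F d in sequentially. B * Cs * C1 * (1 / (real d + 1)) powr \<gamma> < e / 2"
        using \<open>e > 0\<close> by (intro order_tendstoD) auto
      then obtain d' where d': "B * Cs * C1 * (1 / (real d' + 1)) powr \<gamma> < e / 2"
        by (auto simp: eventually_sequentially)
      (* d is chosen so large that the truncated part is harmless; epsilon comes after d
         because the bound for the rest degrades as d grows *)
      define d where "d = Suc d'"
      have d: "d > 0" "B * Cs * C1 * (1 / real d) powr \<gamma> < e / 2"
        using d' by (auto simp: d_def add.commute)
      define M where "M = 4 * Cs * Cg * real d powr (1 - \<gamma>)"
      have "M > 0" using Cs Cg d by (simp add: M_def)
      define \<epsilon> where "\<epsilon> = e / (2 * M)"
      have "\<epsilon> > 0" using \<open>M > 0\<close> \<open>e > 0\<close> by (simp add: \<epsilon>_def)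
      from partial[OF this] obtain C where "C \<ge> 0"
        and C: "\<And>m. \<bar>\<Sum>j\<le>m. b j\<bar> \<le> \<epsilon> * (real m + 1) + C" by blast
      have "\<bar>?T n\<bar> \<le> (e + M * C / (real n + 1)) * (real n + 1) powr (s + \<gamma> - 1)" for n
      proof -
        define r where "r = real n + 1"
        have r: "r > 0" by (simp add: r_def)
        define L where "L = n div d"
        define v where "v j = rising_coeff \<gamma> (max L (n - j))" for j
        have bulk: "\<bar>\<Sum>j\<le>n. b j * rising_coeff s j * v j\<bar>
            \<le> (M * \<epsilon> + M * C / r) * r powr (s + \<gamma> - 1)"
        proof -
          have "\<bar>\<Sum>j\<le>n. b j * rising_coeff s j * v j\<bar>
              \<le> 2 * (2 * (\<epsilon> * r + C) * rising_coeff s n) * rising_coeff \<gamma> L"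
            unfolding r_def
          proof (rule abel_summation_bound)
            show "mono_on {..n} v \<or> antimono_on {..n} v"
              using False \<gamma> unfolding v_def by (intro disjI1 mono_onI rising_coeff_antimono) auto
            show "0 \<le> v j \<and> v j \<le> rising_coeff \<gamma> L" for j
              using False \<gamma> unfolding v_def by (auto intro!: rising_coeff_antimono less_imp_le[OF rising_coeff_pos])
            show "\<bar>\<Sum>j\<le>m. b j * rising_coeff s j\<bar> \<le> 2 * (\<epsilon> * (real n + 1) + C) * rising_coeff s n"
              if "m \<le> n" for m
              using s C \<open>\<epsilon> > 0\<close> that by (intro weighted_partial_sum_bound) auto
          qed
          also have "rising_coeff \<gamma> L \<le> Cg * (real d powr (1 - \<gamma>) * r powr (\<gamma> - 1))"
          proof -
            have "n < d * (L + 1)" unfolding L_def using d(1)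
              by (metis add.commute dividend_less_times_div mult_Suc_right plus_1_eq_Suc)
            then have "n + 1 \<le> d * (L + 1)" by simp
            then have "real (n + 1) \<le> real (d * (L + 1))" by (rule of_nat_mono)
            then have "r \<le> real d * (real L + 1)" by (simp add: r_def algebra_simps)
            then have "r / real d \<le> real L + 1" using d by (simp add: field_simps)
            then have "(real L + 1) powr (\<gamma> - 1) \<le> (r / real d) powr (\<gamma> - 1)"
              using False d r by (intro powr_mono2') auto
            also have "\<dots> = real d powr (1 - \<gamma>) * r powr (\<gamma> - 1)"
              using d r by (simp add: powr_divide powr_diff field_simps)
            finally show ?thesis using Cg(2) Cg(4)[of L]
              by (meson mult_left_mono less_imp_le order_trans)
          qed
          also have "2 * (2 * (\<epsilon> * r + C) * rising_coeff s n) * (Cg * (real d powr (1 - \<gamma>) * r powr (\<gamma> - 1)))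
            \<le> 2 * (2 * (\<epsilon> * r + C) * (Cs * r powr (s - 1))) * (Cg * (real d powr (1 - \<gamma>) * r powr (\<gamma> - 1)))"
            using Cs(2,4) Cg(2) \<open>\<epsilon> > 0\<close> \<open>C \<ge> 0\<close> r
            by (intro mult_mono mult_left_mono) (auto simp: r_def)
          also have "\<dots> = M * (\<epsilon> + C / r) * (r * r powr (s - 1) * r powr (\<gamma> - 1))"
            using r by (simp add: field_simps M_def)
          also have "r * r powr (s - 1) * r powr (\<gamma> - 1) = r powr (s + \<gamma> - 1)"
            using r by (simp add: powr_mult_base add_diff_eq flip: powr_add)
          also have "M * (\<epsilon> + C / r) = M * \<epsilon> + M * C / r" by (simp add: algebra_simps)
          finally show ?thesis
            using \<open>\<epsilon> > 0\<close> \<open>C \<ge> 0\<close> r rising_coeff_pos[OF \<open>s > 0\<close>, of n] by (simp add: mult_left_mono)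
        qed
        have tail: "\<bar>\<Sum>j\<le>n. b j * rising_coeff s j * (rising_coeff \<gamma> (n - j) - v j)\<bar>
            \<le> B * Cs * C1 * (1 / real d) powr \<gamma> * r powr (s + \<gamma> - 1)"
        proof -
          define w where "w l = (if l < L then rising_coeff \<gamma> l else 0)" for l
          have w: "\<bar>rising_coeff \<gamma> (n - j) - v j\<bar> \<le> w (n - j)" for j
            using False \<gamma> rising_coeff_antimono[of \<gamma> "n - j" L] rising_coeff_pos[OF \<gamma>, of L]
            by (auto simp: v_def w_def max_def)
          have "\<bar>\<Sum>j\<le>n. b j * rising_coeff s j * (rising_coeff \<gamma> (n - j) - v j)\<bar>
             \<le> (\<Sum>j\<le>n. \<bar>b j * rising_coeff s j * (rising_coeff \<gamma> (n - j) - v j)\<bar>)"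
            by (rule sum_abs)
          also have "\<dots> \<le> (\<Sum>j\<le>n. B * rising_coeff s n * w (n - j))"
          proof (rule sum_mono)
            fix j assume "j \<in> {..n}"
            then have "rising_coeff s j \<le> rising_coeff s n" "0 < rising_coeff s j"
              using s \<open>s > 0\<close> by (auto intro!: rising_coeff_mono rising_coeff_pos)
            then show "\<bar>b j * rising_coeff s j * (rising_coeff \<gamma> (n - j) - v j)\<bar> \<le> B * rising_coeff s n * w (n - j)"
              unfolding abs_mult using b[of j] w[of j] B by (intro mult_mono) auto
          qed
          also have "\<dots> = B * rising_coeff s n * (\<Sum>l\<le>n. w l)"
            unfolding sum_distrib_left
            by (rule sum.reindex_bij_witness[of _ "\<lambda>l. n - l" "\<lambda>l. n - l"]) auto
          also have "(\<Sum>l\<le>n. w l) \<le> C1 * (r / real d) powr \<gamma>"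
          proof -
            have L: "L \<le> n" by (simp add: L_def)
            have "(\<Sum>l\<le>n. w l) = (\<Sum>l<L. rising_coeff \<gamma> l)"
              unfolding w_def using L by (intro sum.mono_neutral_cong_right) auto
            also have "\<dots> \<le> C1 * real L powr \<gamma>"
            proof (cases L)
              case (Suc l)
              then show ?thesis using C1(4)[of l]
                by (simp add: lessThan_Suc_atMost sum_rising_coeff add.commute)
            qed auto
            also have "C1 * real L powr \<gamma> \<le> C1 * (r / real d) powr \<gamma>"
            proof -
              have "L * d \<le> n" unfolding L_def by simp
              then have "real (L * d) \<le> real n" by (rule of_nat_mono)
              then have "real L \<le> r / real d" using d by (simp add: r_def field_simps)
              then show ?thesis using C1(2) \<gamma> by (intro mult_left_mono powr_mono2) auto
            qed
            finally show ?thesis .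
          qed
          also have "B * rising_coeff s n * (C1 * (r / real d) powr \<gamma>)
              \<le> B * (Cs * r powr (s - 1)) * (C1 * (r / real d) powr \<gamma>)"
            using Cs(4)[of n] B C1(2) by (intro mult_right_mono mult_left_mono) (auto simp: r_def)
          also have "\<dots> = B * Cs * C1 * (1 / real d) powr \<gamma> * (r powr (s - 1) * r powr \<gamma>)"
            using d r by (simp add: powr_divide)
          also have "r powr (s - 1) * r powr \<gamma> = r powr (s + \<gamma> - 1)"
            using r by (simp add: algebra_simps flip: powr_add)
          finally show ?thesis
            using B rising_coeff_pos[OF \<open>s > 0\<close>, of n] by (simp add: mult_left_mono)
        qed
        have "?T n = (\<Sum>j\<le>n. b j * rising_coeff s j * v j) +
            (\<Sum>j\<le>n. b j * rising_coeff s j * (rising_coeff \<gamma> (n - j) - v j))"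
          by (simp add: algebra_simps flip: sum.distrib)
        then have "\<bar>?T n\<bar> \<le> (M * \<epsilon> + M * C / r) * r powr (s + \<gamma> - 1) +
            B * Cs * C1 * (1 / real d) powr \<gamma> * r powr (s + \<gamma> - 1)"
          using bulk tail by linarith
        also have "\<dots> = (M * \<epsilon> + B * Cs * C1 * (1 / real d) powr \<gamma> + M * C / r) * r powr (s + \<gamma> - 1)"
          by (simp add: algebra_simps)
        also have "\<dots> \<le> (e + M * C / r) * r powr (s + \<gamma> - 1)"
          using d(2) \<open>M > 0\<close> by (intro mult_right_mono) (auto simp: \<epsilon>_def)
        finally show ?thesis by (simp add: r_def)
      qed
      then show "\<exists>A. \<forall>n. \<bar>?T n\<bar> \<le> (e + A / (real n + 1)) * (real n + 1) powr (s + \<gamma> - 1)" by blast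
    qed
  qed
qed

text \<open>
  The difference splits into three convolutions: with the error of \<open>y\<close>, with the error of \<open>x\<close>, and
  with the centred sequence \<open>b j - \<mu>\<close>. The main term is an exact convolution of coefficients.
\<close>
lemma cesaro_convolution:
  fixes b x y :: "nat \<Rightarrow> real"
  assumes s: "s \<ge> 1" and \<gamma>: "\<gamma> > 0" and b: "\<And>j. \<bar>b j\<bar> \<le> B"
    and mean: "(\<lambda>n. \<Sum>j\<le>n. b j - \<mu>) \<in> o(\<lambda>n. real n + 1)"
    and x: "(\<lambda>j. x j - b j * rising_coeff s j) \<in> o(rising_coeff s)"
    and y: "(\<lambda>j. y j - c * rising_coeff \<gamma> j) \<in> o(rising_coeff \<gamma>)"
  shows "(\<lambda>n. (\<Sum>j\<le>n. x j * y (n - j)) - \<mu> * c * rising_coeff (s + \<gamma>) n) \<in> o(rising_coeff (s + \<gamma>))"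
proof -
  have "s > 0" using s by simp
  have brc: "(\<lambda>j. b j * rising_coeff s j) \<in> O(rising_coeff s)"
    using b by (intro bigoI[where c=B] always_eventually) (auto simp: abs_mult intro!: mult_right_mono)
  have x': "x \<in> O(rising_coeff s)"
    using sum_in_bigo(1)[OF landau_o.small_imp_big[OF x] brc] by simp
  have y': "y \<in> O(rising_coeff \<gamma>)"
    using sum_in_bigo(1)[OF landau_o.small_imp_big[OF y], of "\<lambda>j. c * rising_coeff \<gamma> j"] by simp
  have 1: "(\<lambda>n. \<Sum>j\<le>n. x j * (y (n - j) - c * rising_coeff \<gamma> (n - j))) \<in> o(rising_coeff (s + \<gamma>))"
    by (rule convolution_smallo[OF \<open>s > 0\<close> \<gamma> x' y])
  have "(\<lambda>n. \<Sum>j\<le>n. rising_coeff \<gamma> j * (x (n - j) - b (n - j) * rising_coeff s (n - j)))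
      \<in> o(rising_coeff (\<gamma> + s))"
    by (rule convolution_smallo[OF \<gamma> \<open>s > 0\<close> _ x]) simp
  also have "(\<lambda>n. \<Sum>j\<le>n. rising_coeff \<gamma> j * (x (n - j) - b (n - j) * rising_coeff s (n - j))) =
      (\<lambda>n. \<Sum>j\<le>n. (x j - b j * rising_coeff s j) * rising_coeff \<gamma> (n - j))"
  proof
    fix n
    show "(\<Sum>j\<le>n. rising_coeff \<gamma> j * (x (n - j) - b (n - j) * rising_coeff s (n - j))) =
      (\<Sum>j\<le>n. (x j - b j * rising_coeff s j) * rising_coeff \<gamma> (n - j))"
      by (rule sum.reindex_bij_witness[where i = "\<lambda>j. n - j" and j = "\<lambda>j. n - j"]) auto
  qed
  finally have 2: "(\<lambda>n. \<Sum>j\<le>n. (x j - b j * rising_coeff s j) * rising_coeff \<gamma> (n - j))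
      \<in> o(rising_coeff (s + \<gamma>))" by (simp add: add.commute)
  have "\<bar>b j - \<mu>\<bar> \<le> B + \<bar>\<mu>\<bar>" for j using b[of j] by linarith
  from cesaro_null_convolution[OF s \<gamma> this mean]
  have 3: "(\<lambda>n. \<Sum>j\<le>n. (b j - \<mu>) * rising_coeff s j * rising_coeff \<gamma> (n - j)) \<in> o(rising_coeff (s + \<gamma>))" .
  have eq: "(\<Sum>j\<le>n. x j * y (n - j)) - \<mu> * c * rising_coeff (s + \<gamma>) n
    = (\<Sum>j\<le>n. x j * (y (n - j) - c * rising_coeff \<gamma> (n - j)))
    + (c * (\<Sum>j\<le>n. (x j - b j * rising_coeff s j) * rising_coeff \<gamma> (n - j))
    + c * (\<Sum>j\<le>n. (b j - \<mu>) * rising_coeff s j * rising_coeff \<gamma> (n - j)))" for n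
    unfolding rising_coeff_convolution[symmetric] sum_distrib_left sum.distrib[symmetric] sum_subtractf[symmetric]
    by (intro sum.cong refl) (simp add: algebra_simps)
  show ?thesis
    unfolding eq using 1 2 3 by (cases "c = 0") (auto intro!: sum_in_smallo)
qed

section \<open>Removing a marked cycle from a permutation\<close>

text \<open>
  Arbitrary ground sets are needed here, because removing a cycle from a permutation of \<open>{1..n}\<close> leaves
  a permutation of a set that is not an initial segment.
\<close>
definition cycles_on :: "'a set \<Rightarrow> ('a \<Rightarrow> 'a) \<Rightarrow> 'a set set" where
  "cycles_on A \<sigma> = orbit \<sigma> ` A"

definition cycle_sum :: "(nat \<Rightarrow> real) \<Rightarrow> 'a set \<Rightarrow> ('a \<Rightarrow> 'a) \<Rightarrow> real" where
  "cycle_sum g A \<sigma> = (\<Sum>c\<in>cycles_on A \<sigma>. g (card c))"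

definition perm_sum :: "real \<Rightarrow> (nat \<Rightarrow> real) \<Rightarrow> 'a set \<Rightarrow> (real \<Rightarrow> real) \<Rightarrow> real" where
  "perm_sum \<theta> g A F = (\<Sum>\<sigma> | \<sigma> permutes A. \<theta> ^ card (cycles_on A \<sigma>) * F (cycle_sum g A \<sigma>))"

definition cyclic_perms :: "'a set \<Rightarrow> ('a \<Rightarrow> 'a) set" where
  "cyclic_perms D = {\<tau>. \<tau> permutes D \<and> cyclic_on \<tau> D}"

lemma cycles_on_subset:
  assumes "\<sigma> permutes A" "c \<in> cycles_on A \<sigma>"
  shows "c \<subseteq> A"
  using assms permutes_orbit_subset by (fastforce simp: cycles_on_def)

lemma cycles_on_nonempty: "c \<in> cycles_on A \<sigma> \<Longrightarrow> c \<noteq> {}"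
  by (auto simp: cycles_on_def orbit_nonempty)

lemma finite_cycles_on: "finite A \<Longrightarrow> finite (cycles_on A \<sigma>)"
  by (simp add: cycles_on_def)

lemma self_in_orbit_permutes:
  "finite A \<Longrightarrow> \<sigma> permutes A \<Longrightarrow> x \<in> orbit \<sigma> x"
  by (rule permutation_self_in_orbit) (auto simp: permutation_permutes)

text \<open>Conjugation by a bijection preserves the cycle type.\<close>
lemma perm_sum_bij:
  assumes f: "bij_betw f A B" and A: "finite A"
  shows "perm_sum \<theta> g A F = perm_sum \<theta> g B F"
proof -
  define h where "h \<pi> x = (if x \<in> B then f (\<pi> (inv_into A f x)) else x)" for \<pi> x
  have bij: "bij_betw h {\<pi>. \<pi> permutes A} {\<pi>. \<pi> permutes B}"
    using bij_betw_permutations[OF f] by (simp add: h_def[abs_def])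
  have inj: "inj_on f A" using f by (simp add: bij_betw_def)
  have cyc: "cycles_on B (h \<pi>) = (`) f ` cycles_on A \<pi>" if \<pi>: "\<pi> permutes A" for \<pi>
  proof -
    have "f ` orbit \<pi> a = orbit (h \<pi>) (f a)" if a: "a \<in> A" for a
    proof (rule orbit_inverse)
      show "a \<in> orbit \<pi> a" by (rule self_in_orbit_permutes[OF A \<pi>])
      fix x assume "x \<in> orbit \<pi> a"
      then have "x \<in> A" using permutes_orbit_subset[OF \<pi> a] by auto
      then show "h \<pi> (f x) = f (\<pi> x)"
        using f inj by (auto simp: h_def bij_betw_def)
    qed
    moreover have "B = f ` A" using f by (simp add: bij_betw_def)
    ultimately show ?thesis by (auto simp: cycles_on_def image_image)
  qed
  have inj': "inj_on ((`) f) (cycles_on A \<pi>)" if "\<pi> permutes A" for \<pi>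
  proof (rule inj_on_subset)
    show "inj_on ((`) f) (Pow A)" using inj by (rule inj_on_image_Pow)
    show "cycles_on A \<pi> \<subseteq> Pow A" using cycles_on_subset[OF that] by auto
  qed
  have card_eq: "card (f ` c) = card c" if "\<pi> permutes A" "c \<in> cycles_on A \<pi>" for \<pi> c
    using inj_on_subset[OF inj cycles_on_subset[OF that]] by (rule card_image)
  have "perm_sum \<theta> g B F = (\<Sum>\<pi> | \<pi> permutes A. \<theta> ^ card (cycles_on B (h \<pi>)) * F (cycle_sum g B (h \<pi>)))"
    unfolding perm_sum_def by (rule sum.reindex_bij_betw[OF bij, symmetric])
  also have "\<dots> = perm_sum \<theta> g A F"
    unfolding perm_sum_def
  proof (intro sum.cong refl, goal_cases)
    case (1 \<pi>)
    then have \<pi>: "\<pi> permutes A" by simp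
    have "cycle_sum g B (h \<pi>) = cycle_sum g A \<pi>"
      unfolding cycle_sum_def cyc[OF \<pi>]
      by (subst sum.reindex[OF inj'[OF \<pi>]]) (simp add: card_eq[OF \<pi>])
    then show ?case by (simp add: cyc[OF \<pi>] card_image[OF inj'[OF \<pi>]])
  qed
  finally show ?thesis by simp
qed

lemma cycles_on_comp:
  assumes A: "finite A" and "D \<subseteq> A" and \<tau>: "\<tau> \<in> cyclic_perms D" and \<rho>: "\<rho> permutes (A - D)"
  shows "\<tau> \<circ> \<rho> permutes A" "cycles_on A (\<tau> \<circ> \<rho>) = insert D (cycles_on (A - D) \<rho>)"
    "D \<notin> cycles_on (A - D) \<rho>"
proof -
  have \<tau>': "\<tau> permutes D" "cyclic_on \<tau> D" using \<tau> by (auto simp: cyclic_perms_def)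
  have "D \<noteq> {}" using \<tau>'(2) by (auto simp: cyclic_on_def)
  show "\<tau> \<circ> \<rho> permutes A"
    using permutes_subset[OF \<tau>'(1)] permutes_subset[OF \<rho>] \<open>D \<subseteq> A\<close> by (intro permutes_compose) auto
  have 1: "orbit (\<tau> \<circ> \<rho>) x = D" if "x \<in> D" for x
  proof -
    have "cyclic_on (\<tau> \<circ> \<rho>) D"
      by (rule permutes_comp_preserves_cyclic1[OF \<rho> \<tau>'(2), of D]) auto
    then show ?thesis using that by (rule orbit_cyclic_eq3)
  qed
  have 2: "orbit (\<tau> \<circ> \<rho>) x = orbit \<rho> x" if "x \<in> A - D" for x
  proof -
    have "finite (A - D)" using A by simp
    then have "cyclic_on \<rho> (orbit \<rho> x)" "x \<in> orbit \<rho> x"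
      using cyclic_on_orbit[OF \<rho>] self_in_orbit_permutes[OF _ \<rho>] by auto
    then have "cyclic_on (\<tau> \<circ> \<rho>) (orbit \<rho> x)"
      using permutes_orbit_subset[OF \<rho> that]
      by (intro permutes_comp_preserves_cyclic2[OF \<tau>'(1), where B = "A - D"]) auto
    then show ?thesis using \<open>x \<in> orbit \<rho> x\<close> by (rule orbit_cyclic_eq3)
  qed
  have "cycles_on A (\<tau> \<circ> \<rho>) = orbit (\<tau> \<circ> \<rho>) ` D \<union> orbit (\<tau> \<circ> \<rho>) ` (A - D)"
    using \<open>D \<subseteq> A\<close> by (auto simp: cycles_on_def)
  also have "orbit (\<tau> \<circ> \<rho>) ` D = {D}" using 1 \<open>D \<noteq> {}\<close> by auto
  also have "orbit (\<tau> \<circ> \<rho>) ` (A - D) = cycles_on (A - D) \<rho>" using 2 by (simp add: cycles_on_def)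
  finally show "cycles_on A (\<tau> \<circ> \<rho>) = insert D (cycles_on (A - D) \<rho>)"
    by (simp only: insert_is_Un[symmetric])
  show "D \<notin> cycles_on (A - D) \<rho>"
    using cycles_on_subset[OF \<rho>] \<open>D \<noteq> {}\<close> by blast
qed

lemma cycle_split_bij:
  assumes A: "finite A" and D: "D \<subseteq> A" "D \<noteq> {}"
  shows "bij_betw (\<lambda>(\<tau>, \<rho>). \<tau> \<circ> \<rho>) (cyclic_perms D \<times> {\<rho>. \<rho> permutes (A - D)})
           {\<sigma>. \<sigma> permutes A \<and> D \<in> cycles_on A \<sigma>}"
proof (rule bij_betw_byWitness[where f' = "\<lambda>\<sigma>. (perm_restrict \<sigma> D, perm_restrict \<sigma> (A - D))"])
  show "(\<lambda>(\<tau>, \<rho>). \<tau> \<circ> \<rho>) ` (cyclic_perms D \<times> {\<rho>. \<rho> permutes A - D})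
      \<subseteq> {\<sigma>. \<sigma> permutes A \<and> D \<in> cycles_on A \<sigma>}"
    using cycles_on_comp[OF A D(1)] by auto
  show "\<forall>a\<in>cyclic_perms D \<times> {\<rho>. \<rho> permutes A - D}.
       (\<lambda>\<sigma>. (perm_restrict \<sigma> D, perm_restrict \<sigma> (A - D))) (case a of (\<tau>, \<rho>) \<Rightarrow> \<tau> \<circ> \<rho>) = a"
  proof (clarify, intro conjI ext)
    fix \<tau> \<rho> x assume "\<tau> \<in> cyclic_perms D" and \<rho>: "\<rho> permutes A - D"
    then have \<tau>: "\<tau> permutes D" by (simp add: cyclic_perms_def)
    show "perm_restrict (\<tau> \<circ> \<rho>) D x = \<tau> x"
      using permutes_not_in[OF \<tau>, of x] permutes_not_in[OF \<rho>, of x] by (auto simp: perm_restrict_def)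
    show "perm_restrict (\<tau> \<circ> \<rho>) (A - D) x = \<rho> x"
      using permutes_not_in[OF \<tau>, of "\<rho> x"] permutes_not_in[OF \<rho>, of x] permutes_in_image[OF \<rho>, of x]
      by (auto simp: perm_restrict_def)
  qed
  have cyc: "cyclic_on \<sigma> D" if "\<sigma> permutes A" "D \<in> cycles_on A \<sigma>" for \<sigma>
    using that A by (auto simp: cycles_on_def intro: cyclic_on_orbit)
  have restr: "perm_restrict \<sigma> D permutes D" if \<sigma>: "\<sigma> permutes A" "D \<in> cycles_on A \<sigma>" for \<sigma>
  proof -
    have "A - (A - D) = D" using D by auto
    have "finite D" using A D by (rule_tac finite_subset)
    have "\<sigma> ` D \<subseteq> D" using cyclic_on_inI[OF cyc[OF \<sigma>]] by auto
    then have "\<sigma> ` D = D"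
      using \<open>finite D\<close> permutes_inj_on[OF \<sigma>(1)] by (intro endo_inj_surj) auto
    then have "bij_betw (perm_restrict \<sigma> D) D D"
      using permutes_inj_on[OF \<sigma>(1), of D] by (auto simp: bij_betw_def perm_restrict_def inj_on_def)
    then show ?thesis by (rule bij_imp_permutes) (simp add: perm_restrict_def)
  qed
  show "\<forall>\<sigma>\<in>{\<sigma>. \<sigma> permutes A \<and> D \<in> cycles_on A \<sigma>}.
       (case (perm_restrict \<sigma> D, perm_restrict \<sigma> (A - D)) of (\<tau>, \<rho>) \<Rightarrow> \<tau> \<circ> \<rho>) = \<sigma>"
  proof
    fix \<sigma> assume "\<sigma> \<in> {\<sigma>. \<sigma> permutes A \<and> D \<in> cycles_on A \<sigma>}"
    then have \<sigma>: "\<sigma> permutes A" "D \<in> cycles_on A \<sigma>" by auto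
    have "perm_restrict \<sigma> D \<circ> perm_restrict \<sigma> (A - D) = perm_restrict \<sigma> (D \<union> (A - D))"
      using restr[OF \<sigma>] perm_restrict_diff_cyclic[OF \<sigma>(1) cyc[OF \<sigma>]]
      by (intro perm_restrict_union) auto
    also have "D \<union> (A - D) = A" using D by auto
    also have "perm_restrict \<sigma> A = \<sigma>" using \<sigma>(1) by simp
    finally show "(case (perm_restrict \<sigma> D, perm_restrict \<sigma> (A - D)) of (\<tau>, \<rho>) \<Rightarrow> \<tau> \<circ> \<rho>) = \<sigma>"
      by (simp only: prod.case)
  qed
  show "(\<lambda>\<sigma>. (perm_restrict \<sigma> D, perm_restrict \<sigma> (A - D))) ` {\<sigma>. \<sigma> permutes A \<and> D \<in> cycles_on A \<sigma>}
    \<subseteq> cyclic_perms D \<times> {\<rho>. \<rho> permutes A - D}"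
  proof
    fix \<pi> assume "\<pi> \<in> (\<lambda>\<sigma>. (perm_restrict \<sigma> D, perm_restrict \<sigma> (A - D))) ` {\<sigma>. \<sigma> permutes A \<and> D \<in> cycles_on A \<sigma>}"
    then obtain \<sigma> where \<sigma>: "\<sigma> permutes A" "D \<in> cycles_on A \<sigma>"
      and \<pi>: "\<pi> = (perm_restrict \<sigma> D, perm_restrict \<sigma> (A - D))" by auto
    show "\<pi> \<in> cyclic_perms D \<times> {\<rho>. \<rho> permutes A - D}"
      using restr[OF \<sigma>] cyc[OF \<sigma>] perm_restrict_diff_cyclic[OF \<sigma>(1) cyc[OF \<sigma>]]
      by (simp add: \<pi> cyclic_perms_def cyclic_on_perm_restrict)
  qed
qed

text \<open>
  The factor \<open>x\<close> is the sum of \<open>g (card D)\<close> over the cycles \<open>D\<close> of the permutation. After exchanging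
  the sums, a set \<open>D\<close> is fixed and the permutations having \<open>D\<close> as a cycle are pairs of a cyclic
  permutation of \<open>D\<close> and any permutation of the rest.
\<close>
lemma perm_sum_split:
  assumes A: "finite A"
  shows "perm_sum \<theta> g A (\<lambda>x. x * F x) = (\<Sum>D\<in>Pow A - {{}}.
    \<theta> * real (card (cyclic_perms D)) * g (card D) * perm_sum \<theta> g (A - D) (\<lambda>x. F (g (card D) + x)))"
proof -
  let ?P = "{\<sigma>. \<sigma> permutes A}"
  let ?w = "\<lambda>\<sigma>. \<theta> ^ card (cycles_on A \<sigma>) * F (cycle_sum g A \<sigma>)"
  have fin: "finite ?P" "finite (Pow A - {{}})" using A by (auto simp: finite_permutations)
  have "perm_sum \<theta> g A (\<lambda>x. x * F x) = (\<Sum>\<sigma>\<in>?P. \<Sum>D\<in>cycles_on A \<sigma>. g (card D) * ?w \<sigma>)"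
    unfolding perm_sum_def
    by (intro sum.cong refl) (simp add: cycle_sum_def sum_distrib_right sum_distrib_left mult_ac)
  also have "\<dots> = (\<Sum>\<sigma>\<in>?P. \<Sum>D\<in>Pow A - {{}}. if D \<in> cycles_on A \<sigma> then g (card D) * ?w \<sigma> else 0)"
  proof (rule sum.cong[OF refl])
    fix \<sigma> assume "\<sigma> \<in> ?P"
    then have "cycles_on A \<sigma> \<subseteq> Pow A - {{}}"
      using cycles_on_subset[of \<sigma> A] cycles_on_nonempty[of _ A \<sigma>] by auto
    then have "(Pow A - {{}}) \<inter> {D. D \<in> cycles_on A \<sigma>} = cycles_on A \<sigma>" by auto
    then show "(\<Sum>D\<in>cycles_on A \<sigma>. g (card D) * ?w \<sigma>) =
        (\<Sum>D\<in>Pow A - {{}}. if D \<in> cycles_on A \<sigma> then g (card D) * ?w \<sigma> else 0)"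
      using fin(2) by (simp add: sum.If_cases)
  qed
  also have "\<dots> = (\<Sum>D\<in>Pow A - {{}}. \<Sum>\<sigma>\<in>?P. if D \<in> cycles_on A \<sigma> then g (card D) * ?w \<sigma> else 0)"
    by (rule sum.swap)
  also have "\<dots> = (\<Sum>D\<in>Pow A - {{}}.
    \<theta> * real (card (cyclic_perms D)) * g (card D) * perm_sum \<theta> g (A - D) (\<lambda>x. F (g (card D) + x)))"
  proof (intro sum.cong refl)
    fix D assume "D \<in> Pow A - {{}}"
    then have D: "D \<subseteq> A" "D \<noteq> {}" by auto
    let ?Q = "{\<sigma>. \<sigma> permutes A \<and> D \<in> cycles_on A \<sigma>}"
    let ?R = "{\<rho>. \<rho> permutes (A - D)}"
    have "(\<Sum>\<sigma>\<in>?P. if D \<in> cycles_on A \<sigma> then g (card D) * ?w \<sigma> else 0) = (\<Sum>\<sigma>\<in>?Q. g (card D) * ?w \<sigma>)"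
      using fin(1) by (simp add: sum.If_cases Int_def)
    also have "\<dots> = (\<Sum>(\<tau>, \<rho>)\<in>cyclic_perms D \<times> ?R. g (card D) * ?w (\<tau> \<circ> \<rho>))"
      by (subst sum.reindex_bij_betw[OF cycle_split_bij[OF A D], symmetric]) (simp add: case_prod_unfold)
    also have "\<dots> = (\<Sum>(\<tau>, \<rho>)\<in>cyclic_perms D \<times> ?R. g (card D) * (\<theta> *
        (\<theta> ^ card (cycles_on (A - D) \<rho>) * F (g (card D) + cycle_sum g (A - D) \<rho>))))"
    proof (intro sum.cong refl, clarify)
      fix \<tau> \<rho> assume *: "\<tau> \<in> cyclic_perms D" "\<rho> permutes A - D"
      have f: "finite (cycles_on (A - D) \<rho>)" using A by (simp add: finite_cycles_on)
      show "g (card D) * ?w (\<tau> \<circ> \<rho>) = g (card D) * (\<theta> *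
        (\<theta> ^ card (cycles_on (A - D) \<rho>) * F (g (card D) + cycle_sum g (A - D) \<rho>)))"
        using cycles_on_comp[OF A D(1) *] f by (simp add: cycle_sum_def)
    qed
    also have "\<dots> = \<theta> * real (card (cyclic_perms D)) * g (card D) *
        perm_sum \<theta> g (A - D) (\<lambda>x. F (g (card D) + x))"
      unfolding perm_sum_def
      by (simp add: sum.cartesian_product[symmetric] sum_distrib_left mult_ac)
    finally show "(\<Sum>\<sigma>\<in>?P. if D \<in> cycles_on A \<sigma> then g (card D) * ?w \<sigma> else 0) =
      \<theta> * real (card (cyclic_perms D)) * g (card D) * perm_sum \<theta> g (A - D) (\<lambda>x. F (g (card D) + x))" .
  qed
  finally show ?thesis .
qed

lemma sum_card_cycles_on:
  assumes "finite A" "\<sigma> permutes A"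
  shows "cycle_sum real A \<sigma> = real (card A)"
proof -
  have cyc: "cyclic_on \<sigma> c" if "c \<in> cycles_on A \<sigma>" for c
    using that assms by (auto simp: cycles_on_def intro: cyclic_on_orbit)
  have "\<Union> (cycles_on A \<sigma>) = A"
    using cycles_on_subset[OF assms(2)] self_in_orbit_permutes[OF assms] by (auto simp: cycles_on_def)
  moreover have "card (\<Union> (cycles_on A \<sigma>)) = (\<Sum>c\<in>cycles_on A \<sigma>. card c)"
  proof (rule card_Union_disjoint)
    show "pairwise disjnt (cycles_on A \<sigma>)"
      unfolding pairwise_def disjnt_def
    proof (intro ballI impI)
      fix c d assume "c \<in> cycles_on A \<sigma>" "d \<in> cycles_on A \<sigma>" "c \<noteq> d"
      then show "c \<inter> d = {}" using orbit_cyclic_eq3[OF cyc] by (metis disjoint_iff)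
    qed
    show "finite c" if "c \<in> cycles_on A \<sigma>" for c
      using cycles_on_subset[OF assms(2) that] assms(1) by (rule finite_subset)
  qed
  ultimately show ?thesis by (simp add: cycle_sum_def)
qed

lemma sum_Pow_by_card:
  assumes "finite A"
  shows "(\<Sum>D\<in>Pow A - {{}}. h (card D)) = (\<Sum>j=1..card A. real (card A choose j) * h j)"
proof -
  have "(\<Sum>D\<in>Pow A - {{}}. h (card D)) = (\<Sum>j=1..card A. \<Sum>D | D \<in> Pow A - {{}} \<and> card D = j. h (card D))"
    using assms
    by (intro sum.group[symmetric]) (auto intro!: card_mono simp: Suc_le_eq card_gt_0_iff finite_subset)
  also have "\<dots> = (\<Sum>j=1..card A. real (card A choose j) * h j)"
  proof (intro sum.cong refl)
    fix j assume "j \<in> {1..card A}"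
    then have "{D. D \<in> Pow A - {{}} \<and> card D = j} = {D. D \<subseteq> A \<and> card D = j}" by auto
    then show "(\<Sum>D | D \<in> Pow A - {{}} \<and> card D = j. h (card D)) = real (card A choose j) * h j"
      using n_subsets[OF assms, of j] by (simp)
  qed
  finally show ?thesis .
qed

lemma perm_sum_unweighted: "finite A \<Longrightarrow> perm_sum 1 g A (\<lambda>_. 1) = fact (card A)"
  by (simp add: perm_sum_def card_permutations)

text \<open>
  The splitting formula counts the cyclic permutations by itself. For \<open>\<theta> = 1\<close> and \<open>g\<close> the identity the
  left-hand side is \<open>n * n!\<close>, as the cycle lengths add up to \<open>n\<close>. On the right, by induction, each of the
  sizes \<open>1, \<dots>, n - 1\<close> of proper subsets accounts for \<open>n!\<close>. So \<open>n!\<close> is left for the full set, which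
  enters with the factor \<open>n\<close>.
\<close>
lemma card_cyclic_perms:
  assumes "finite D" "D \<noteq> {}"
  shows "real (card (cyclic_perms D)) = fact (card D - 1)"
  using assms
proof (induction "card D" arbitrary: D rule: less_induct)
  case less
  define n where "n = card D"
  have n: "n > 0" using less.prems by (simp add: n_def card_gt_0_iff)
  let ?h = "\<lambda>j. (fact j * fact (n - j) :: real)"
  have term_eq: "real (card (cyclic_perms C)) * real (card C) * fact (card (D - C))
      = ?h (card C)" if "C \<in> Pow D - {{}} - {D}" for C
  proof -
    have C: "C \<subseteq> D" "C \<noteq> {}" "C \<noteq> D" using that by auto
    then have "card C < card D" using less.prems by (simp add: psubset_card_mono psubset_eq)
    moreover have "finite C" using C less.prems finite_subset by blast
    moreover from this C have "card C > 0" by (simp add: card_gt_0_iff)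
    ultimately show ?thesis
      using less.hyps[of C] C by (simp add: card_Diff_subset n_def fact_reduce[of "card C"] mult_ac)
  qed
  have "perm_sum 1 real D (\<lambda>x. x * 1) = (\<Sum>\<sigma> | \<sigma> permutes D. real n)"
    unfolding perm_sum_def using less.prems
    by (intro sum.cong refl) (simp add: sum_card_cycles_on n_def)
  then have "real n * fact n = perm_sum 1 real D (\<lambda>x. x * 1)"
    using less.prems by (simp add: card_permutations n_def mult.commute)
  also have "\<dots> = (\<Sum>C\<in>Pow D - {{}}. real (card (cyclic_perms C)) * real (card C) * fact (card (D - C)))"
    using less.prems by (subst perm_sum_split) (auto simp: perm_sum_unweighted intro!: sum.cong)
  also have "\<dots> = real (card (cyclic_perms D)) * real n +
      (\<Sum>C\<in>Pow D - {{}} - {D}. real (card (cyclic_perms C)) * real (card C) * fact (card (D - C)))"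
    using less.prems by (subst sum.remove[where x = D]) (auto simp: n_def)
  also have "\<dots> = real (card (cyclic_perms D)) * real n + (\<Sum>C\<in>Pow D - {{}} - {D}. ?h (card C))"
    using term_eq by simp
  also have "(\<Sum>C\<in>Pow D - {{}} - {D}. ?h (card C)) = (\<Sum>C\<in>Pow D - {{}}. ?h (card C)) - fact n"
    using less.prems by (subst sum.remove[where x = D and A = "Pow D - {{}}"]) (auto simp: n_def)
  also have "(\<Sum>C\<in>Pow D - {{}}. ?h (card C)) = (\<Sum>j=1..n. real (n choose j) * ?h j)"
    using sum_Pow_by_card[OF less.prems(1), of ?h] by (simp add: n_def)
  also have "\<dots> = (\<Sum>j=1..n. fact n)"
    by (intro sum.cong refl) (simp add: binomial_fact)
  finally have "real (card (cyclic_perms D)) * real n = fact n" by simp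
  also have "(fact n :: real) = fact (n - 1) * real n" using n by (simp add: fact_reduce)
  finally show ?case using n by (simp add: n_def)
qed

section \<open>Size biasing under the Ewens weights\<close>

text \<open>
  The normalisation by \<open>n!\<close> turns the binomial coefficients of the splitting formula into a plain
  convolution in \<open>n\<close>.
\<close>
definition ewens_sum :: "real \<Rightarrow> (nat \<Rightarrow> real) \<Rightarrow> nat \<Rightarrow> (real \<Rightarrow> real) \<Rightarrow> real" where
  "ewens_sum \<theta> g n F = perm_sum \<theta> g {1..n} F / fact n"

lemma ewens_sum_size_bias:
  "ewens_sum \<theta> g n (\<lambda>x. x * F x) =
     \<theta> * (\<Sum>j=1..n. g j / real j * ewens_sum \<theta> g (n - j) (\<lambda>x. F (g j + x)))"
proof -
  let ?h = "\<lambda>j. \<theta> * fact (j - 1) * g j * perm_sum \<theta> g {1..n - j} (\<lambda>x. F (g j + x))"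
  have "perm_sum \<theta> g {1..n} (\<lambda>x. x * F x) = (\<Sum>D\<in>Pow {1..n} - {{}}. ?h (card D))"
    unfolding perm_sum_split[OF finite_atLeastAtMost]
  proof (intro sum.cong refl)
    fix D assume "D \<in> Pow {1..n} - {{}}"
    then have D: "D \<subseteq> {1..n}" "D \<noteq> {}" "finite D" by (auto intro: finite_subset)
    have "card ({1..n} - D) = card {1..n - card D}" using D by (simp add: card_Diff_subset)
    then obtain f where "bij_betw f ({1..n} - D) {1..n - card D}"
      using finite_same_card_bij[of "{1..n} - D" "{1..n - card D}"] by auto
    then have "perm_sum \<theta> g ({1..n} - D) F' = perm_sum \<theta> g {1..n - card D} F'" for F'
      by (rule perm_sum_bij) simp
    then show "\<theta> * real (card (cyclic_perms D)) * g (card D) *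
        perm_sum \<theta> g ({1..n} - D) (\<lambda>x. F (g (card D) + x)) = ?h (card D)"
      using D by (simp add: card_cyclic_perms)
  qed
  also have "\<dots> = (\<Sum>j=1..n. real (n choose j) * ?h j)"
    using sum_Pow_by_card[of "{1..n}" ?h] by simp
  finally show ?thesis
    unfolding ewens_sum_def
    by (simp add: sum_divide_distrib sum_distrib_left)
      (intro sum.cong refl, auto simp: binomial_fact fact_reduce)
qed

text \<open>
  The sum does not depend on \<open>g\<close>. With \<open>g\<close> the identity, size biasing gives the recursion of
  \<open>rising_coeff_size_bias\<close>.
\<close>
lemma ewens_sum_total: "ewens_sum \<theta> g n (\<lambda>_. 1) = rising_coeff \<theta> n"
proof -
  have indep: "ewens_sum \<theta> g n (\<lambda>_. 1) = ewens_sum \<theta> real n (\<lambda>_. 1)" for n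
    by (simp add: ewens_sum_def perm_sum_def)
  have "ewens_sum \<theta> real n (\<lambda>_. 1) = rising_coeff \<theta> n"
  proof (induction n rule: less_induct)
    case (less n)
    show ?case
    proof (cases "n = 0")
      case True
      then show ?thesis
        by (simp add: ewens_sum_def perm_sum_def rising_coeff_def cycles_on_def)
    next
      case False
      have "real n * ewens_sum \<theta> real n (\<lambda>_. 1) = ewens_sum \<theta> real n (\<lambda>x. x * 1)"
        unfolding ewens_sum_def perm_sum_def times_divide_eq_right sum_distrib_left
        by (intro arg_cong2[where f = "(/)"] sum.cong refl) (simp add: sum_card_cycles_on)
      also have "\<dots> = \<theta> * (\<Sum>j=1..n. ewens_sum \<theta> real (n - j) (\<lambda>_. 1))"
        unfolding ewens_sum_size_bias by (auto intro!: sum.cong)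
      also have "(\<Sum>j=1..n. ewens_sum \<theta> real (n - j) (\<lambda>_. 1)) = (\<Sum>l<n. rising_coeff \<theta> l)"
        by (rule sum.reindex_bij_witness[of _ "\<lambda>l. n - l" "\<lambda>j. n - j"]) (auto simp: less)
      also have "\<theta> * \<dots> = real n * rising_coeff \<theta> n"
        by (simp add: rising_coeff_size_bias)
      finally show ?thesis using False by simp
    qed
  qed
  then show ?thesis by (simp add: indep)
qed

section \<open>Equidistribution of a rotation of the torus\<close>

definition unit_interval :: "real measure" where
  "unit_interval = restrict_space lborel {0..1}"

definition unit_square :: "(real \<times> real) measure" where
  "unit_square = unit_interval \<Otimes>\<^sub>M unit_interval"

lemma prob_space_unit_interval: "prob_space unit_interval"
  by (rule prob_spaceI) (simp add: unit_interval_def emeasure_restrict_space space_restrict_space)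

interpretation unit_interval: prob_space unit_interval
  by (rule prob_space_unit_interval)

interpretation unit_square: pair_prob_space unit_interval unit_interval ..

lemma measurable_unit_interval:
  "f \<in> measurable borel M \<Longrightarrow> f \<in> measurable unit_interval M"
  unfolding unit_interval_def by (rule measurable_restrict_space1) simp

lemma measurable_unit_square:
  assumes "f \<in> measurable borel M"
  shows "f \<in> measurable unit_square M"
proof -
  have id: "(\<lambda>x. x) \<in> measurable unit_interval borel" by (rule measurable_unit_interval) simp
  have "(\<lambda>p. (fst p, snd p)) \<in> measurable unit_square (borel \<Otimes>\<^sub>M borel)"
    unfolding unit_square_def
    by (intro measurable_Pair measurable_compose[OF measurable_fst id] measurable_compose[OF measurable_snd id])
  then have "(\<lambda>p. p) \<in> measurable unit_square borel" by (simp add: borel_prod)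
  from measurable_compose[OF this assms] show ?thesis .
qed

lemma integrable_unit_square:
  fixes f :: "real \<times> real \<Rightarrow> 'b :: {banach, second_countable_topology}"
  assumes "f \<in> borel_measurable borel" "\<And>p. norm (f p) \<le> B"
  shows "integrable unit_square f"
  using measurable_unit_square[OF assms(1)] assms(2)
  unfolding unit_square_def by (intro unit_square.integrable_const_bound[where B = B]) auto

lemma integral_unit_square:
  fixes f :: "real \<times> real \<Rightarrow> 'b :: {banach, second_countable_topology}"
  assumes "integrable unit_square f"
  shows "integral\<^sup>L unit_square f = (\<integral>x. (\<integral>y. f (x, y) \<partial>unit_interval) \<partial>unit_interval)"
  using unit_square.integral_fst'[of f] assms by (simp add: unit_square_def)

lemma AE_unit_interval: "AE x in unit_interval. 0 < x \<and> x < 1"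
proof -
  have "AE x in lborel. x \<in> {0..1::real} \<longrightarrow> 0 < x \<and> x < 1"
    using AE_lborel_singleton[of "0::real"] AE_lborel_singleton[of "1::real"]
    by eventually_elim auto
  then show ?thesis
    unfolding unit_interval_def by (subst AE_restrict_space_iff) auto
qed

lemma integral_unit_interval_FTC:
  fixes f :: "real \<Rightarrow> 'b :: euclidean_space"
  assumes "\<And>x. (F has_vector_derivative f x) (at x)" "continuous_on UNIV f"
  shows "(\<integral>x. f x \<partial>unit_interval) = F 1 - F 0"
proof -
  have "(\<integral>x. f x \<partial>unit_interval) = (\<integral>x. indicator {0..1} x *\<^sub>R f x \<partial>lborel)"
    unfolding unit_interval_def by (rule integral_restrict_space) simp
  also have "\<dots> = F 1 - F 0"
    using assms by (intro integral_FTC_Icc) (auto intro: has_vector_derivative_at_within continuous_on_subset)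
  finally show ?thesis .
qed

abbreviation circle :: "real \<Rightarrow> complex" where
  "circle x \<equiv> cis (2 * pi * x)"

abbreviation torus :: "real \<times> real \<Rightarrow> complex \<times> complex" where
  "torus p \<equiv> (circle (fst p), circle (snd p))"

lemma circle_eq_1_iff: "circle x = 1 \<longleftrightarrow> x \<in> \<int>"
proof -
  have "circle x = 1 \<longleftrightarrow> exp (of_real (2 * pi * x) * \<i>) = 1"
    by (simp add: cis_conv_exp mult.commute)
  also have "\<dots> \<longleftrightarrow> (\<exists>n::int. 2 * pi * x = of_int (2 * n) * pi)"
    by (simp add: exp_eq_1)
  also have "\<dots> \<longleftrightarrow> x \<in> \<int>" by (auto simp: Ints_def)
  finally show ?thesis .
qed

lemma integral_circle:
  fixes a :: int
  shows "(\<integral>x. circle (of_int a * x) \<partial>unit_interval) = (if a = 0 then 1 else 0)"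
proof (cases "a = 0")
  case True
  then show ?thesis using unit_interval.prob_space by simp
next
  case False
  define c :: complex where "c = \<i> * of_real (2 * pi * of_int a)"
  have "c \<noteq> 0" using False by (simp add: c_def)
  have e: "circle (of_int a * x) = exp (c * of_real x)" for x
    by (simp add: cis_conv_exp c_def mult_ac)
  have "((\<lambda>x. exp (c * of_real x) / c) has_vector_derivative circle (of_int a * x)) (at x)" for x
  proof -
    have "((\<lambda>z. exp (c * z) / c) has_field_derivative exp (c * of_real x)) (at (of_real x))"
      using \<open>c \<noteq> 0\<close> by (auto intro!: derivative_eq_intros)
    then show ?thesis unfolding e by (rule has_vector_derivative_real_field)
  qed
  then have "(\<integral>x. circle (of_int a * x) \<partial>unit_interval) = exp (c * of_real 1) / c - exp (c * of_real 0) / c"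
    by (rule integral_unit_interval_FTC) (intro continuous_intros)
  also have "exp (c * of_real 1) = 1" using e[of 1, symmetric] by (simp add: circle_eq_1_iff)
  finally show ?thesis using False by simp
qed

text \<open>
  Trigonometric polynomials as the span of the characters of the torus. An inductive predicate lets
  the statements about averages and integrals be checked on a single character only.
\<close>
inductive trig_poly :: "(real \<times> real \<Rightarrow> complex) \<Rightarrow> bool" where
  char: "trig_poly (\<lambda>p. c * (circle (of_int a * fst p) * circle (of_int b * snd p)))"
| add: "trig_poly f \<Longrightarrow> trig_poly g \<Longrightarrow> trig_poly (\<lambda>p. f p + g p)"

lemma trig_poly_mult:
  assumes "trig_poly f" "trig_poly g"
  shows "trig_poly (\<lambda>p. f p * g p)"
  using assms
proof (induction)
  case (char c a b)
  show ?case using \<open>trig_poly g\<close>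
  proof (induction)
    case (char c' a' b')
    have "trig_poly (\<lambda>p. (c * c') * (circle (of_int (a + a') * fst p) * circle (of_int (b + b') * snd p)))"
      by (rule trig_poly.char)
    then show ?case by (simp add: cis_mult[symmetric] ring_distribs mult_ac)
  next
    case (add f g)
    then show ?case by (simp add: ring_distribs trig_poly.add)
  qed
next
  case (add f h)
  then show ?case by (simp add: ring_distribs trig_poly.add)
qed

lemma trig_poly_linear:
  assumes "bounded_linear (f :: complex \<times> complex \<Rightarrow> real)"
  shows "trig_poly (\<lambda>p. of_real (f (torus p)))"
proof -
  interpret bounded_linear f by fact
  have f: "f (z, w) = Re z * f (1, 0) + Im z * f (\<i>, 0) + Re w * f (0, 1) + Im w * f (0, \<i>)" for z w
  proof -
    have "(z, w) = Re z *\<^sub>R (1, 0) + Im z *\<^sub>R (\<i>, 0) + Re w *\<^sub>R (0, 1) + Im w *\<^sub>R (0, \<i>)"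
      by (simp add: complex_eq_iff)
    then show ?thesis by (simp only: add scale) simp
  qed
  have re_im: "trig_poly (\<lambda>p. of_real (Re (circle (h p)) * r))" "trig_poly (\<lambda>p. of_real (Im (circle (h p)) * r))"
    if h: "\<And>c a. trig_poly (\<lambda>p. c * circle (of_int a * h p))" for h r
  proof -
    have "of_real (Re (circle (h p)) * r)
        = of_real r / 2 * circle (of_int 1 * h p) + of_real r / 2 * circle (of_int (- 1) * h p)" for p
      by (simp add: complex_eq_iff)
    then show "trig_poly (\<lambda>p. of_real (Re (circle (h p)) * r))"
      by (simp only: trig_poly.add h)
    have "of_real (Im (circle (h p)) * r)
        = - \<i> * of_real r / 2 * circle (of_int 1 * h p) + \<i> * of_real r / 2 * circle (of_int (- 1) * h p)" for p
      by (simp add: complex_eq_iff)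
    then show "trig_poly (\<lambda>p. of_real (Im (circle (h p)) * r))"
      by (simp only: trig_poly.add h)
  qed
  have "trig_poly (\<lambda>p. c * circle (of_int a * fst p))" "trig_poly (\<lambda>p. c * circle (of_int a * snd p))" for c a
    using trig_poly.char[of c a 0] trig_poly.char[of c 0 a] by simp_all
  note parts = re_im[OF this(1)] re_im[OF this(2)]
  have "f (torus p) = Re (circle (fst p)) * f (1, 0) + Im (circle (fst p)) * f (\<i>, 0)
      + Re (circle (snd p)) * f (0, 1) + Im (circle (snd p)) * f (0, \<i>)" for p
    by (rule f)
  then show ?thesis
    unfolding of_real_add by (simp only: trig_poly.add parts of_real_add)
qed

lemma trig_poly_real_polynomial:
  assumes "real_polynomial_function (f :: complex \<times> complex \<Rightarrow> real)"
  shows "trig_poly (\<lambda>p. of_real (f (torus p)))"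
  using assms
proof (induction)
  case (linear f)
  then show ?case by (rule trig_poly_linear)
next
  case (const c)
  show ?case using trig_poly.char[of "of_real c" 0 0] by simp
next
  case (add f g)
  then show ?case by (auto intro: trig_poly.add)
next
  case (mult f g)
  then show ?case by (auto intro: trig_poly_mult)
qed

lemma trig_poly_integrable:
  assumes "trig_poly f"
  shows "integrable unit_square f"
  using assms
proof (induction)
  case (char c a b)
  show ?case
    by (rule integrable_unit_square[where B = "norm c"])
      (auto simp: norm_mult intro!: borel_measurable_continuous_onI continuous_intros)
qed auto

locale torus_rotation =
  fixes \<alpha> \<beta> :: real
  assumes independent: "\<And>a b :: int. of_int a * \<alpha> + of_int b * \<beta> \<in> \<int> \<Longrightarrow> a = 0 \<and> b = 0"
begin

definition average :: "(real \<times> real \<Rightarrow> 'b) \<Rightarrow> nat \<Rightarrow> 'b :: real_vector" where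
  "average f N = (\<Sum>j<N. f (real j * \<alpha>, real j * \<beta>)) /\<^sub>R real N"

text \<open>
  On a nontrivial character the orbit is a geometric progression with ratio different from \<open>1\<close>, by
  independence. Its partial sums stay bounded, and the integral of the character vanishes.
\<close>
lemma average_trig_poly:
  assumes "trig_poly f"
  shows "average f \<longlonglongrightarrow> integral\<^sup>L unit_square f"
  using assms
proof (induction)
  case (char c a b)
  let ?f = "\<lambda>p. c * (circle (of_int a * fst p) * circle (of_int b * snd p))"
  have "integral\<^sup>L unit_square ?f = (\<integral>x. (\<integral>y. ?f (x, y) \<partial>unit_interval) \<partial>unit_interval)"
    by (intro integral_unit_square trig_poly_integrable trig_poly.char)
  also have "\<dots> = c * (if a = 0 \<and> b = 0 then 1 else 0)"
    by (simp add: integral_circle)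
  also have "\<dots> = (if a = 0 \<and> b = 0 then c else 0)" by simp
  finally have int: "integral\<^sup>L unit_square ?f = (if a = 0 \<and> b = 0 then c else 0)" .
  show ?case
  proof (cases "a = 0 \<and> b = 0")
    case True
    have "\<forall>\<^sub>F N in sequentially. average ?f N = c"
      using eventually_gt_at_top[of 0]
      by eventually_elim (simp add: average_def True scaleR_conv_of_real)
    then have "average ?f \<longlonglongrightarrow> c" by (rule tendsto_eventually)
    then show ?thesis unfolding int if_P[OF True] .
  next
    case False
    define \<omega> where "\<omega> = circle (of_int a * \<alpha> + of_int b * \<beta>)"
    have "\<omega> \<noteq> 1" using False independent by (auto simp: \<omega>_def circle_eq_1_iff)
    have pow: "?f (real j * \<alpha>, real j * \<beta>) = c * \<omega> ^ j" for j
      by (simp add: \<omega>_def Complex.DeMoivre cis_mult algebra_simps)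
    have "norm (average ?f N) \<le> norm c * (2 / norm (1 - \<omega>)) / real N" for N
    proof -
      have "norm (\<Sum>j<N. \<omega> ^ j) = norm (1 - \<omega> ^ N) / norm (1 - \<omega>)"
        using \<open>\<omega> \<noteq> 1\<close> by (simp add: sum_gp_strict norm_divide)
      also have "\<dots> \<le> 2 / norm (1 - \<omega>)"
        using norm_triangle_ineq4[of 1 "\<omega> ^ N"] by (intro divide_right_mono) (auto simp: \<omega>_def norm_power)
      finally have geo: "norm (\<Sum>j<N. \<omega> ^ j) \<le> 2 / norm (1 - \<omega>)" .
      have "average ?f N = (c * (\<Sum>j<N. \<omega> ^ j)) /\<^sub>R real N"
        by (simp only: average_def pow sum_distrib_left)
      then have "norm (average ?f N) = norm c * norm (\<Sum>j<N. \<omega> ^ j) / real N"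
        by (simp only: norm_scaleR norm_mult abs_inverse abs_of_nat divide_inverse mult.commute mult.left_commute)
      also have "\<dots> \<le> norm c * (2 / norm (1 - \<omega>)) / real N"
        by (intro divide_right_mono mult_left_mono geo) auto
      finally show ?thesis .
    qed
    moreover have "(\<lambda>N. norm c * (2 / norm (1 - \<omega>)) / real N) \<longlonglongrightarrow> 0" by real_asymp
    ultimately have "average ?f \<longlonglongrightarrow> 0" by (rule Lim_null_comparison[OF always_eventually, rule_format])
    then show ?thesis using False by (simp only: int if_False)
  qed
next
  case (add f g)
  have "average (\<lambda>p. f p + g p) = (\<lambda>N. average f N + average g N)"
    by (simp add: average_def sum.distrib scaleR_add_right fun_eq_iff)
  moreover have "integral\<^sup>L unit_square (\<lambda>p. f p + g p) = integral\<^sup>L unit_square f + integral\<^sup>L unit_square g"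
    using add.hyps by (intro Bochner_Integration.integral_add trig_poly_integrable)
  ultimately show ?case using add.IH by (simp add: tendsto_add)
qed

lemma average_mono_diff:
  fixes f g :: "real \<times> real \<Rightarrow> real"
  assumes "\<And>p. \<bar>f p - g p\<bar> \<le> h p"
  shows "\<bar>average f N - average g N\<bar> \<le> average h N"
proof -
  have "\<bar>\<Sum>j<N. f (real j * \<alpha>, real j * \<beta>) - g (real j * \<alpha>, real j * \<beta>)\<bar>
      \<le> (\<Sum>j<N. h (real j * \<alpha>, real j * \<beta>))"
    by (rule order_trans[OF sum_abs]) (intro sum_mono assms)
  then show ?thesis
    by (simp add: average_def sum_subtractf divide_inverse_commute[symmetric] diff_divide_distrib[symmetric]
        abs_divide divide_right_mono)
qed

lemma average_const: "N > 0 \<Longrightarrow> average (\<lambda>_. c :: real) N = c"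
  by (simp add: average_def)

text \<open>
  Weyl's sandwich argument: it is enough to approximate \<open>f\<close> from functions that are already understood,
  with a pointwise error whose own average is understood and small.
\<close>
lemma average_approx:
  fixes f :: "real \<times> real \<Rightarrow> real"
  assumes f: "integrable unit_square f"
    and ap: "\<And>e. e > 0 \<Longrightarrow> \<exists>g h. (\<forall>p. \<bar>f p - g p\<bar> \<le> h p) \<and> integrable unit_square g \<and> integrable unit_square h \<and>
        average g \<longlonglongrightarrow> integral\<^sup>L unit_square g \<and> average h \<longlonglongrightarrow> integral\<^sup>L unit_square h \<and>
        integral\<^sup>L unit_square h < e"
  shows "average f \<longlonglongrightarrow> integral\<^sup>L unit_square f"
proof (rule LIMSEQ_I)
  fix e :: real assume "e > 0"
  let ?I = "integral\<^sup>L unit_square"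
  obtain g h where gh: "\<And>p. \<bar>f p - g p\<bar> \<le> h p" "integrable unit_square g" "integrable unit_square h"
    "average g \<longlonglongrightarrow> ?I g" "average h \<longlonglongrightarrow> ?I h" "?I h < e / 4"
    using ap[of "e / 4"] \<open>e > 0\<close> by auto
  have "\<bar>?I f - ?I g\<bar> = \<bar>?I (\<lambda>p. f p - g p)\<bar>" using f gh by simp
  also have "\<dots> \<le> ?I (\<lambda>p. \<bar>f p - g p\<bar>)" by (rule integral_abs_bound)
  also have "\<dots> \<le> ?I h" using f gh by (intro integral_mono) auto
  finally have 1: "\<bar>?I f - ?I g\<bar> \<le> ?I h" .
  have "\<forall>\<^sub>F N in sequentially. \<bar>average g N - ?I g\<bar> < e / 4"
    using gh(4) \<open>e > 0\<close> by (auto simp: tendsto_iff dist_real_def dest: spec[of _ "e / 4"])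
  moreover have "\<forall>\<^sub>F N in sequentially. average h N < e / 4"
    using order_tendstoD(2)[OF gh(5,6)] .
  ultimately have "\<forall>\<^sub>F N in sequentially. \<bar>average f N - ?I f\<bar> < e"
  proof eventually_elim
    case (elim N)
    then show ?case using average_mono_diff[of f g h N, OF gh(1)] 1 gh(6) by linarith
  qed
  then show "\<exists>no. \<forall>n\<ge>no. norm (average f n - ?I f) < e" by (simp add: eventually_sequentially)
qed

text \<open>By Stone and Weierstrass, polynomials in the coordinates of the torus approximate uniformly.\<close>
lemma average_continuous:
  fixes G :: "complex \<times> complex \<Rightarrow> real"
  assumes G: "continuous_on (sphere 0 1 \<times> sphere 0 1) G"
  shows "integrable unit_square (\<lambda>p. G (torus p))" (is ?int)
    and "average (\<lambda>p. G (torus p)) \<longlonglongrightarrow> (\<integral>p. G (torus p) \<partial>unit_square)"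
proof -
  let ?S = "sphere 0 1 \<times> sphere 0 1 :: (complex \<times> complex) set"
  have S: "compact ?S" by (intro compact_Times) auto
  have torus: "torus p \<in> ?S" for p by simp
  have int: "integrable unit_square (\<lambda>p. H (torus p))" if H: "continuous_on ?S H" for H :: "_ \<Rightarrow> real"
  proof -
    have "bounded (H ` ?S)" using compact_continuous_image[OF H S] by (rule compact_imp_bounded)
    then obtain B where B: "\<And>z. z \<in> ?S \<Longrightarrow> norm (H z) \<le> B" by (auto simp: bounded_iff)
    have "continuous_on UNIV (\<lambda>p. H (torus p))"
      using torus by (intro continuous_on_compose2[OF H] continuous_intros) auto
    then show ?thesis
      using B[OF torus] by (intro integrable_unit_square[where B = B] borel_measurable_continuous_onI)
  qed
  show ?int by (rule int[OF G])
  show "average (\<lambda>p. G (torus p)) \<longlonglongrightarrow> (\<integral>p. G (torus p) \<partial>unit_square)"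
  proof (rule average_approx[OF int[OF G]])
    fix e :: real assume "e > 0"
    then have "e / 2 > 0" by simp
    obtain g where g: "real_polynomial_function g" "\<And>z. z \<in> ?S \<Longrightarrow> \<bar>G z - g z\<bar> < e / 2"
      using Stone_Weierstrass_real_polynomial_function[OF S G \<open>e / 2 > 0\<close>] by blast
    have tp: "trig_poly (\<lambda>p. of_real (g (torus p)))" by (rule trig_poly_real_polynomial[OF g(1)])
    have "average (\<lambda>p. complex_of_real (g (torus p))) = (\<lambda>N. complex_of_real (average (\<lambda>p. g (torus p)) N))"
      by (simp add: average_def fun_eq_iff scaleR_conv_of_real)
    with average_trig_poly[OF tp]
    have "(\<lambda>N. complex_of_real (average (\<lambda>p. g (torus p)) N)) \<longlonglongrightarrow> complex_of_real (\<integral>p. g (torus p) \<partial>unit_square)"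
      by simp
    then have "average (\<lambda>p. g (torus p)) \<longlonglongrightarrow> (\<integral>p. g (torus p) \<partial>unit_square)"
      by (simp add: tendsto_of_real_iff)
    moreover have "integrable unit_square (\<lambda>p. g (torus p))"
      using trig_poly_integrable[OF tp] by (simp add: complex_of_real_integrable_eq)
    moreover have "\<bar>G (torus p) - g (torus p)\<bar> \<le> e / 2" for p using g(2)[OF torus[of p]] by simp
    moreover have "average (\<lambda>_. e / 2) \<longlonglongrightarrow> (\<integral>p. e / 2 \<partial>unit_square)"
    proof -
      have "\<forall>\<^sub>F N in sequentially. average (\<lambda>_. e / 2) N = e / 2"
        using eventually_gt_at_top[of 0] by eventually_elim (rule average_const)
      then have "average (\<lambda>_. e / 2) \<longlonglongrightarrow> e / 2" by (rule tendsto_eventually)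
      moreover have "(\<integral>p. e / 2 \<partial>unit_square) = e / 2"
        using unit_square.P.prob_space by (simp add: unit_square_def)
      ultimately show ?thesis by (simp only:)
    qed
    moreover have "integrable unit_square (\<lambda>_. e / 2)" "(\<integral>p. e / 2 \<partial>unit_square) < e"
      using \<open>e > 0\<close> unit_square.P.prob_space by (auto simp: unit_square_def)
    ultimately show "\<exists>g h. (\<forall>p. \<bar>G (torus p) - g p\<bar> \<le> h p) \<and> integrable unit_square g \<and> integrable unit_square h \<and>
        average g \<longlonglongrightarrow> integral\<^sup>L unit_square g \<and> average h \<longlonglongrightarrow> integral\<^sup>L unit_square h \<and>
        integral\<^sup>L unit_square h < e"
      by (intro exI[of _ "\<lambda>p. g (torus p)"] exI[of _ "\<lambda>_. e / 2"] conjI allI)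
  qed
qed

end

text \<open>
  As a function on the circle, the fractional part jumps at \<open>1\<close>. Multiplied by a cutoff that vanishes
  there it becomes continuous, at the cost of an error supported near \<open>1\<close>.
\<close>
definition angle :: "complex \<Rightarrow> real" where
  "angle z = Arg2pi z / (2 * pi)"

definition cutoff :: "real \<Rightarrow> complex \<Rightarrow> real" where
  "cutoff \<eta> z = min 1 (norm (z - 1) / \<eta>)"

lemma angle_circle: "angle (circle x) = frac x"
proof -
  have "circle x = circle (frac x) * circle (of_int \<lfloor>x\<rfloor>)"
    by (simp add: cis_mult frac_def algebra_simps)
  also have "circle (of_int \<lfloor>x\<rfloor>) = 1" by (simp add: circle_eq_1_iff)
  finally have "circle x = circle (frac x)" by simp
  moreover have "Arg2pi (circle (frac x)) = 2 * pi * frac x"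
    using frac_lt_1[of x] by (intro Arg2pi_unique[where r = 1]) (auto simp: cis_conv_exp)
  ultimately show ?thesis by (simp add: angle_def)
qed

lemma angle_bounds: "0 \<le> angle z" "angle z < 1"
  using Arg2pi[of z] by (simp_all add: angle_def)

lemma cutoff_bounds: "\<eta> > 0 \<Longrightarrow> 0 \<le> cutoff \<eta> z" "\<eta> > 0 \<Longrightarrow> cutoff \<eta> z \<le> 1"
  by (simp_all add: cutoff_def)

lemma continuous_cutoff: "continuous_on S (cutoff \<eta>)"
  unfolding cutoff_def[abs_def] divide_inverse by (intro continuous_intros)

lemma continuous_angle_cutoff:
  assumes "\<eta> > 0"
  shows "continuous_on (sphere 0 1) (\<lambda>z. angle z * cutoff \<eta> z)"
  unfolding continuous_on_eq_continuous_within
proof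
  fix z :: complex assume z: "z \<in> sphere 0 1"
  show "continuous (at z within sphere 0 1) (\<lambda>z. angle z * cutoff \<eta> z)"
  proof (cases "z = 1")
    case True
    have "((\<lambda>z. cutoff \<eta> z) \<longlongrightarrow> cutoff \<eta> 1) (at 1)"
      using continuous_cutoff[of UNIV \<eta>] by (simp add: continuous_on_def)
    moreover have "cutoff \<eta> 1 = 0" by (simp add: cutoff_def)
    ultimately have "(cutoff \<eta> \<longlongrightarrow> 0) (at 1)" by simp
    then have "((\<lambda>z. angle z * cutoff \<eta> z) \<longlongrightarrow> 0) (at 1)"
    proof (rule Lim_null_comparison[rotated])
      have "norm (angle z * cutoff \<eta> z) \<le> cutoff \<eta> z" for z
        using angle_bounds[of z] cutoff_bounds[OF assms, of z]
        by (simp add: abs_mult mult_left_le_one_le)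
      then show "\<forall>\<^sub>F z in at 1. norm (angle z * cutoff \<eta> z) \<le> cutoff \<eta> z" by simp
    qed
    then show ?thesis
      using True by (simp add: continuous_within tendsto_within_subset[of _ _ _ UNIV] cutoff_def)
  next
    case False
    have "z \<notin> \<real>\<^sub>\<ge>\<^sub>0"
    proof
      assume "z \<in> \<real>\<^sub>\<ge>\<^sub>0"
      then obtain r where "r \<ge> 0" "z = of_real r" by (auto elim: nonneg_Reals_cases)
      then show False using z False by simp
    qed
    then have "continuous (at z within sphere 0 1) Arg2pi"
      by (rule continuous_at_imp_continuous_within[OF continuous_at_Arg2pi])
    moreover have "continuous (at z within sphere 0 1) (cutoff \<eta>)"
      using continuous_cutoff[of "sphere 0 1" \<eta>] z by (simp add: continuous_on_eq_continuous_within)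
    ultimately show ?thesis
      unfolding angle_def divide_inverse by (intro continuous_mult continuous_const)
  qed
qed

lemma abs_frac_diff_le_1: "\<bar>frac x - frac y\<bar> \<le> (1 :: real)"
  using frac_ge_0[of x] frac_ge_0[of y] frac_lt_1[of x] frac_lt_1[of y] by linarith

lemma power_diff_bound:
  fixes u v :: real
  assumes "\<bar>u\<bar> \<le> 1" "\<bar>v\<bar> \<le> 1"
  shows "\<bar>u ^ q - v ^ q\<bar> \<le> real q * \<bar>u - v\<bar>"
  using norm_power_diff[of u v q] assms by simp

lemma integrable_unit_interval:
  fixes f :: "real \<Rightarrow> 'b :: {banach, second_countable_topology}"
  assumes "f \<in> borel_measurable borel" "\<And>x. norm (f x) \<le> B"
  shows "integrable unit_interval f"
  using measurable_unit_interval[OF assms(1)] assms(2)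
  by (intro unit_interval.integrable_const_bound[where B = B]) auto

lemma measurable_cutoff_circle [measurable]: "(\<lambda>x. cutoff \<eta> (circle x)) \<in> borel_measurable borel"
  by (intro borel_measurable_continuous_onI continuous_on_compose2[OF continuous_cutoff[of UNIV]] continuous_intros) auto

text \<open>As \<open>\<eta>\<close> tends to \<open>0\<close>, the cutoff tends to \<open>1\<close> except at integers; dominated convergence applies.\<close>
lemma integral_cutoff_small:
  assumes "e > 0"
  obtains \<eta> where "\<eta> > 0" "(\<integral>x. 1 - cutoff \<eta> (circle x) \<partial>unit_interval) < e"
proof -
  define \<eta> where "\<eta> n = 1 / (real n + 1)" for n
  have \<eta>: "\<eta> n > 0" for n by (simp add: \<eta>_def)
  have "(\<lambda>n. \<integral>x. 1 - cutoff (\<eta> n) (circle x) \<partial>unit_interval) \<longlonglongrightarrow> (\<integral>x. 0 \<partial>unit_interval)"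
  proof (rule integral_dominated_convergence[where w = "\<lambda>_. 1"])
    show "AE x in unit_interval. (\<lambda>n. 1 - cutoff (\<eta> n) (circle x)) \<longlonglongrightarrow> 0"
      using AE_unit_interval
    proof eventually_elim
      case (elim x)
      have "x \<notin> \<int>"
      proof
        assume "x \<in> \<int>"
        then obtain k :: int where "x = of_int k" by (auto elim: Ints_cases)
        then have "0 < k" "k < 1" using elim by auto
        then show False by simp
      qed
      then have d: "norm (circle x - 1) > 0" using circle_eq_1_iff[of x] by simp
      have "\<eta> \<longlonglongrightarrow> 0" unfolding \<eta>_def by real_asymp
      then have "\<forall>\<^sub>F n in sequentially. \<eta> n < norm (circle x - 1)"
        using d by (rule order_tendstoD)
      then have "\<forall>\<^sub>F n in sequentially. 1 - cutoff (\<eta> n) (circle x) = 0"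
        by eventually_elim (use \<eta> in \<open>simp add: cutoff_def min_def\<close>)
      then show ?case by (rule tendsto_eventually)
    qed
    show "AE x in unit_interval. norm (1 - cutoff (\<eta> n) (circle x)) \<le> 1" for n
      using cutoff_bounds[OF \<eta>[of n]] by simp
    show "(\<lambda>x. 1 - cutoff (\<eta> n) (circle x)) \<in> borel_measurable unit_interval" for n
      by (rule measurable_unit_interval) simp
  qed auto
  then have "\<forall>\<^sub>F n in sequentially. (\<integral>x. 1 - cutoff (\<eta> n) (circle x) \<partial>unit_interval) < e"
    using assms by (intro order_tendstoD) auto
  then obtain n where "(\<integral>x. 1 - cutoff (\<eta> n) (circle x) \<partial>unit_interval) < e"
    by (auto simp: eventually_sequentially)
  with \<eta> show thesis by (rule that)
qed

lemma has_derivative_affine_power: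
  "((\<lambda>x :: real. (c * x + d) ^ Suc n / real (Suc n)) has_real_derivative c * (c * x + d) ^ n) (at x)"
proof -
  have "((\<lambda>x. (c * x + d) ^ Suc n) has_real_derivative (1 + real n) * (c * (c * x + d) ^ n)) (at x)"
    by (rule DERIV_power_Suc) (auto intro!: derivative_eq_intros)
  from DERIV_cdivide[OF this, of "real (Suc n)"] show ?thesis by (simp add: add.commute)
qed

lemma integral_frac_diff_power:
  "(\<integral>p. (frac (fst p) - frac (snd p)) ^ q \<partial>unit_square) = (1 + (- 1) ^ q) / real ((q + 1) * (q + 2))"
  and integrable_frac_diff_power: "integrable unit_square (\<lambda>p. (frac (fst p) - frac (snd p)) ^ q)"
proof -
  have frac_eq: "frac x = x" if "0 < x \<and> x < 1" for x :: real
    using that by (simp add: frac_eq)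
  have [measurable]: "(\<lambda>p :: real \<times> real. (frac (fst p) - frac (snd p)) ^ q) \<in> borel_measurable borel"
    unfolding frac_def borel_prod[symmetric] by measurable
  show int: "integrable unit_square (\<lambda>p. (frac (fst p) - frac (snd p)) ^ q)"
    using abs_frac_diff_le_1 by (intro integrable_unit_square[where B = 1]) (auto simp: power_abs power_le_one)
  have inner: "(\<integral>y. (frac x - frac y) ^ q \<partial>unit_interval) = (x ^ (q + 1) - (x - 1) ^ (q + 1)) / real (q + 1)"
    if x: "0 < x \<and> x < 1" for x
  proof -
    have m: "(\<lambda>y. (frac x - frac y) ^ q) \<in> borel_measurable unit_interval"
      "(\<lambda>y. (x - y) ^ q) \<in> borel_measurable unit_interval"
      unfolding frac_def by (intro measurable_unit_interval; measurable)+
    have "(\<integral>y. (frac x - frac y) ^ q \<partial>unit_interval) = (\<integral>y. (x - y) ^ q \<partial>unit_interval)"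
    proof (rule integral_cong_AE[OF m])
      show "AE y in unit_interval. (frac x - frac y) ^ q = (x - y) ^ q"
        using AE_unit_interval by eventually_elim (simp add: frac_eq x)
    qed
    also have "\<dots> = - ((- 1 * 1 + x) ^ Suc q / real (Suc q)) - - ((- 1 * 0 + x) ^ Suc q / real (Suc q))"
    proof (rule integral_unit_interval_FTC)
      show "((\<lambda>y. - ((- 1 * y + x) ^ Suc q / real (Suc q))) has_vector_derivative (x - y) ^ q) (at y)" for y
        using DERIV_minus[OF has_derivative_affine_power[of "- 1" x q y]]
        by (simp add: has_real_derivative_iff_has_vector_derivative)
    qed (intro continuous_intros)
    finally show ?thesis by (simp add: diff_divide_distrib)
  qed
  have "(\<integral>p. (frac (fst p) - frac (snd p)) ^ q \<partial>unit_square)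
      = (\<integral>x. (\<integral>y. (frac x - frac y) ^ q \<partial>unit_interval) \<partial>unit_interval)"
    using integral_unit_square[OF int] by simp
  also have "\<dots> = (\<integral>x. (x ^ (q + 1) - (x - 1) ^ (q + 1)) / real (q + 1) \<partial>unit_interval)"
  proof (rule integral_cong_AE)
    show "(\<lambda>x. \<integral>y. (frac x - frac y) ^ q \<partial>unit_interval) \<in> borel_measurable unit_interval"
      using unit_square.integrable_fst'[of "\<lambda>p. (frac (fst p) - frac (snd p)) ^ q"] int
      by (simp add: unit_square_def)
    show "(\<lambda>x. (x ^ (q + 1) - (x - 1) ^ (q + 1)) / real (q + 1)) \<in> borel_measurable unit_interval"
      by (rule measurable_unit_interval) measurable
    show "AE x in unit_interval. (\<integral>y. (frac x - frac y) ^ q \<partial>unit_interval)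
        = (x ^ (q + 1) - (x - 1) ^ (q + 1)) / real (q + 1)"
      using AE_unit_interval by eventually_elim (rule inner)
  qed
  also have "\<dots> = ((1 * 1 + 0) ^ Suc (q + 1) / real (Suc (q + 1)) - (1 * 1 + - 1) ^ Suc (q + 1) / real (Suc (q + 1))) / real (q + 1)
      - ((1 * 0 + 0) ^ Suc (q + 1) / real (Suc (q + 1)) - (1 * 0 + - 1) ^ Suc (q + 1) / real (Suc (q + 1))) / real (q + 1)"
  proof (rule integral_unit_interval_FTC)
    show "((\<lambda>x. ((1 * x + 0) ^ Suc (q + 1) / real (Suc (q + 1)) - (1 * x + - 1) ^ Suc (q + 1) / real (Suc (q + 1))) / real (q + 1))
        has_vector_derivative (x ^ (q + 1) - (x - 1) ^ (q + 1)) / real (q + 1)) (at x)" for x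
      using DERIV_cdivide[OF DERIV_diff[OF has_derivative_affine_power[of 1 0 "q + 1" x]
            has_derivative_affine_power[of 1 "- 1" "q + 1" x]], of "real (q + 1)"]
      by (simp add: has_real_derivative_iff_has_vector_derivative)
  qed (intro continuous_intros, auto)
  also have "\<dots> = (1 + (- 1) ^ q) / real (Suc (q + 1)) / real (q + 1)"
    by (simp add: add_divide_distrib)
  also have "\<dots> = (1 + (- 1) ^ q) / real ((q + 1) * (q + 2))"
    by (simp only: of_nat_mult divide_divide_eq_left mult.commute) simp
  finally show "(\<integral>p. (frac (fst p) - frac (snd p)) ^ q \<partial>unit_square) = (1 + (- 1) ^ q) / real ((q + 1) * (q + 2))" .
qed

lemma (in torus_rotation) average_frac_diff_power:
  "average (\<lambda>p. (frac (fst p) - frac (snd p)) ^ q) \<longlonglongrightarrow> (1 + (- 1) ^ q) / real ((q + 1) * (q + 2))"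
  unfolding integral_frac_diff_power[symmetric]
proof (rule average_approx[OF integrable_frac_diff_power])
  fix e :: real assume "e > 0"
  (* the error bound H integrates to 2 q times the integral of 1 - cutoff; q + 1 covers q = 0 *)
  define e' where "e' = e / (2 * (real q + 1))"
  have "e' > 0" using \<open>e > 0\<close> by (simp add: e'_def)
  then obtain \<eta> where \<eta>: "\<eta> > 0" "(\<integral>x. 1 - cutoff \<eta> (circle x) \<partial>unit_interval) < e'"
    by (rule integral_cutoff_small)
  let ?S = "sphere 0 1 \<times> sphere 0 1 :: (complex \<times> complex) set"
  define \<phi> where "\<phi> z = angle z * cutoff \<eta> z" for z
  define G where "G = (\<lambda>z. (\<phi> (fst z) - \<phi> (snd z)) ^ q)"
  define H where "H = (\<lambda>z. real q * ((1 - cutoff \<eta> (fst z)) + (1 - cutoff \<eta> (snd z))))"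
  have cont: "continuous_on ?S G" "continuous_on ?S H"
    unfolding G_def H_def \<phi>_def
    by (intro continuous_intros continuous_on_compose2[OF continuous_angle_cutoff[OF \<eta>(1)]]
          continuous_on_compose2[OF continuous_cutoff[of UNIV]]; auto)+
  have close: "\<bar>(frac (fst p) - frac (snd p)) ^ q - G (torus p)\<bar> \<le> H (torus p)" for p
  proof -
    have \<phi>: "0 \<le> \<phi> (circle x)" "\<phi> (circle x) \<le> frac x" "frac x - \<phi> (circle x) \<le> 1 - cutoff \<eta> (circle x)" for x
    proof -
      define a c where "a = frac x" and "c = cutoff \<eta> (circle x)"
      have ac: "0 \<le> a" "a \<le> 1" "0 \<le> c" "c \<le> 1"
        using frac_lt_1[of x] cutoff_bounds[OF \<eta>(1), of "circle x"] by (auto simp: a_def c_def less_imp_le)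
      have "\<phi> (circle x) = a * c" by (simp add: \<phi>_def angle_circle a_def c_def)
      moreover have "a * c \<le> a" "0 \<le> a * c" using ac by (auto simp: mult_left_le)
      moreover have "a * (1 - c) \<le> 1 * (1 - c)" using ac by (intro mult_right_mono) auto
      then have "a - a * c \<le> 1 - c" by (simp add: algebra_simps)
      ultimately show "0 \<le> \<phi> (circle x)" "\<phi> (circle x) \<le> frac x" "frac x - \<phi> (circle x) \<le> 1 - cutoff \<eta> (circle x)"
        by (simp_all only: a_def c_def)
    qed
    let ?u = "frac (fst p) - frac (snd p)" and ?v = "\<phi> (circle (fst p)) - \<phi> (circle (snd p))"
    have "\<bar>?u\<bar> \<le> 1" "\<bar>?v\<bar> \<le> 1"
      using \<phi>[of "fst p"] \<phi>[of "snd p"] frac_lt_1[of "fst p"] frac_lt_1[of "snd p"]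
        frac_ge_0[of "fst p"] frac_ge_0[of "snd p"] by linarith+
    then have "\<bar>?u ^ q - ?v ^ q\<bar> \<le> real q * \<bar>?u - ?v\<bar>" by (rule power_diff_bound)
    also have "\<dots> \<le> H (torus p)"
      unfolding H_def using \<phi>[of "fst p"] \<phi>[of "snd p"] by (intro mult_left_mono) auto
    finally show ?thesis by (simp add: G_def)
  qed
  define h where "h x = 1 - cutoff \<eta> (circle x)" for x
  have intc: "integrable unit_interval h"
    unfolding h_def using cutoff_bounds[OF \<eta>(1)] by (intro integrable_unit_interval[where B = 1]) auto
  have "(\<integral>p. H (torus p) \<partial>unit_square) = (\<integral>x. (\<integral>y. H (torus (x, y)) \<partial>unit_interval) \<partial>unit_interval)"
    by (intro integral_unit_square average_continuous cont)
  also have "\<dots> = (\<integral>x. (\<integral>y. real q * (h x + h y) \<partial>unit_interval) \<partial>unit_interval)"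
    by (simp only: H_def h_def fst_conv snd_conv)
  also have "\<dots> = real q * (2 * (\<integral>x. h x \<partial>unit_interval))"
    using intc unit_interval.prob_space by simp
  also have "\<dots> \<le> real q * (2 * e')" using \<eta>(2) by (intro mult_left_mono) (auto simp: h_def)
  also have "\<dots> < e" using \<open>e > 0\<close> by (simp add: e'_def field_simps)
  finally have small: "(\<integral>p. H (torus p) \<partial>unit_square) < e" .
  show "\<exists>g h. (\<forall>p. \<bar>(frac (fst p) - frac (snd p)) ^ q - g p\<bar> \<le> h p) \<and>
      integrable unit_square g \<and> integrable unit_square h \<and>
      average g \<longlonglongrightarrow> integral\<^sup>L unit_square g \<and> average h \<longlonglongrightarrow> integral\<^sup>L unit_square h \<and>
      integral\<^sup>L unit_square h < e"
    by (intro exI[of _ "\<lambda>p. G (torus p)"] exI[of _ "\<lambda>p. H (torus p)"] conjI allI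
        close average_continuous cont small)
qed

section \<open>The method of moments on a compact interval\<close>

lemma integrable_power_bounded:
  fixes M :: "real measure"
  assumes "real_distribution M" "AE x in M. \<bar>x\<bar> \<le> 1"
  shows "integrable M (\<lambda>x. x ^ m)" "(\<integral>x. \<bar>x\<bar> ^ m \<partial>M) \<le> 1"
proof -
  interpret real_distribution M by fact
  have ae: "AE x in M. norm (x ^ m) \<le> 1" "AE x in M. norm (\<bar>x\<bar> ^ m) \<le> 1"
    using assms(2) by (eventually_elim, simp add: power_abs power_le_one)+
  show "integrable M (\<lambda>x. x ^ m)"
    by (rule integrable_const_bound[OF ae(1)]) simp
  have int: "integrable M (\<lambda>x. \<bar>x\<bar> ^ m)"
    by (rule integrable_const_bound[OF ae(2)]) simp
  have "(\<integral>x. \<bar>x\<bar> ^ m \<partial>M) \<le> (\<integral>x. 1 \<partial>M)"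
    using ae(2) by (intro integral_mono_AE int) (auto elim!: eventually_mono)
  then show "(\<integral>x. \<bar>x\<bar> ^ m \<partial>M) \<le> 1" using prob_space by simp
qed

text \<open>
  All absolute moments are at most \<open>1\<close>, so the Taylor polynomials of the characteristic function
  approximate it at a rate that is the same for all such distributions. This uniformity carries
  convergence of moments over to characteristic functions.
\<close>
lemma char_moment_approx:
  fixes M :: "real measure"
  assumes "real_distribution M" "AE x in M. \<bar>x\<bar> \<le> 1"
  shows "norm (char M t - (\<Sum>k\<le>N. (\<i> * t) ^ k / fact k * (\<integral>x. x ^ k \<partial>M))) \<le> 2 * \<bar>t\<bar> ^ N / fact N"
proof -
  interpret real_distribution M by fact
  have "norm (char M t - (\<Sum>k\<le>N. (\<i> * t) ^ k / fact k * (\<integral>x. x ^ k \<partial>M)))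
      \<le> (2 * \<bar>t\<bar> ^ N / fact N) * (\<integral>x. \<bar>x\<bar> ^ N \<partial>M)"
    using integrable_power_bounded(1)[OF assms] by (rule char_approx1)
  also have "\<dots> \<le> (2 * \<bar>t\<bar> ^ N / fact N) * 1"
    by (intro mult_left_mono integrable_power_bounded(2)[OF assms]) auto
  finally show ?thesis by simp
qed

lemma char_convergence_from_moments:
  fixes \<mu> :: "nat \<Rightarrow> real measure"
  assumes \<mu>: "\<And>n. real_distribution (\<mu> n)" "\<And>n. AE x in \<mu> n. \<bar>x\<bar> \<le> 1"
    and M: "real_distribution M" "AE x in M. \<bar>x\<bar> \<le> 1"
    and lim: "\<And>m. (\<lambda>n. \<integral>x. x ^ m \<partial>\<mu> n) \<longlonglongrightarrow> (\<integral>x. x ^ m \<partial>M)"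
  shows "(\<lambda>n. char (\<mu> n) t) \<longlonglongrightarrow> char M t"
proof (rule LIMSEQ_I)
  fix e :: real assume "e > 0"
  let ?S = "\<lambda>(M :: real measure) N. \<Sum>k\<le>N. (\<i> * t) ^ k / fact k * complex_of_real (\<integral>x. x ^ k \<partial>M)"
  have "(\<lambda>N. 2 * (\<bar>t\<bar> ^ N / fact N)) \<longlonglongrightarrow> 2 * 0"
    using summable_LIMSEQ_zero[OF summable_exp[of "\<bar>t\<bar>"]]
    by (intro tendsto_intros) (simp add: divide_inverse mult.commute)
  then have "\<forall>\<^sub>F N in sequentially. 2 * (\<bar>t\<bar> ^ N / fact N) < e / 3"
    using \<open>e > 0\<close> by (intro order_tendstoD) auto
  then obtain N where N: "2 * \<bar>t\<bar> ^ N / fact N < e / 3"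
    by (auto simp: eventually_sequentially)
  have "(\<lambda>n. ?S (\<mu> n) N) \<longlonglongrightarrow> ?S M N"
    by (intro tendsto_intros lim)
  then have "\<forall>\<^sub>F n in sequentially. dist (?S (\<mu> n) N) (?S M N) < e / 3"
    by (rule tendstoD) (use \<open>e > 0\<close> in simp)
  then have "\<forall>\<^sub>F n in sequentially. norm (?S (\<mu> n) N - ?S M N) < e / 3"
    by (simp only: dist_norm)
  then have "\<forall>\<^sub>F n in sequentially. norm (char (\<mu> n) t - char M t) < e"
  proof eventually_elim
    case (elim n)
    have "norm (a - d) \<le> norm (a - b) + norm (b - c) + norm (d - c)" for a b c d :: complex
      using norm_triangle_ineq4[of "(a - b) + (b - c)" "d - c"] norm_triangle_ineq[of "a - b" "b - c"] by simp
    then have "norm (char (\<mu> n) t - char M t) \<le> norm (char (\<mu> n) t - ?S (\<mu> n) N)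
        + norm (?S (\<mu> n) N - ?S M N) + norm (char M t - ?S M N)" .
    then show ?case
      using elim N char_moment_approx[OF \<mu>, of n t N] char_moment_approx[OF M, of t N] by linarith
  qed
  then show "\<exists>no. \<forall>n\<ge>no. norm (char (\<mu> n) t - char M t) < e" by (simp add: eventually_sequentially)
qed

text \<open>
  Tightness provides a subsequential weak limit \<open>M\<close>. Powers are unbounded functions, so the moments of \<open>M\<close>
  are found by testing with powers of the truncation of \<open>x\<close> to \<open>[-1, 1]\<close>, which are bounded and
  continuous and do not change the integrals, once \<open>M\<close> is known to be carried by \<open>[-1, 1]\<close>. Then
  the whole sequence converges to \<open>M\<close> by Levy's continuity theorem.
\<close>
theorem method_of_moments_bounded:
  fixes \<mu> :: "nat \<Rightarrow> real measure" and c :: "nat \<Rightarrow> real"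
  assumes \<mu>: "\<And>n. real_distribution (\<mu> n)" "\<And>n. AE x in \<mu> n. \<bar>x\<bar> \<le> 1"
    and lim: "\<And>m. (\<lambda>n. \<integral>x. x ^ m \<partial>\<mu> n) \<longlonglongrightarrow> c m"
  obtains M where "real_distribution M" "measure M {-1..1} = 1" "weak_conv_m \<mu> M"
    "\<And>m. (\<integral>x. x ^ m \<partial>M) = c m"
proof -
  have "tight \<mu>"
    unfolding tight_def
  proof (intro conjI allI impI \<mu>)
    fix \<epsilon> :: real assume "\<epsilon> > 0"
    have "measure (\<mu> n) {-2<..1} = 1" for n
    proof -
      interpret real_distribution "\<mu> n" by (rule \<mu>)
      show ?thesis using \<mu>(2)[of n] by (subst prob_eq_1) (auto elim!: eventually_mono)
    qed
    then show "\<exists>a b. a < b \<and> (\<forall>n. 1 - \<epsilon> < measure (\<mu> n) {a<..b})"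
      using \<open>\<epsilon> > 0\<close> by (intro exI[of _ "-2"] exI[of _ 1]) auto
  qed
  from tight_imp_convergent_subsubsequence[OF this strict_mono_id]
  obtain r M where r: "strict_mono r" and M: "real_distribution M" and "weak_conv_m (\<mu> \<circ> id \<circ> r) M"
    by blast
  then have conv: "weak_conv_m (\<lambda>n. \<mu> (r n)) M" by (simp add: comp_def)
  interpret M: real_distribution M by fact
  have int_lim: "(\<lambda>n. \<integral>x. f x \<partial>\<mu> (r n)) \<longlonglongrightarrow> (\<integral>x. f x \<partial>M)"
    if "\<And>x. isCont f x" "\<And>x. \<bar>f x\<bar> \<le> 1" for f :: "real \<Rightarrow> real"
    using weak_conv_imp_integral_bdd_continuous_conv[OF \<mu>(1) M conv, of f 1] that by simp
  have meas: "f \<in> borel_measurable N" if "real_distribution N" "\<And>x. isCont f x" for f :: "real \<Rightarrow> real" and N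
  proof -
    interpret real_distribution N by fact
    have "f \<in> borel_measurable borel"
      using that by (intro borel_measurable_continuous_onI continuous_at_imp_continuous_on) auto
    then show ?thesis by simp
  qed
  have supp: "AE x in M. \<bar>x\<bar> \<le> 1"
  proof -
    define f :: "real \<Rightarrow> real" where "f x = min 1 (max 0 (\<bar>x\<bar> - 1))" for x
    have f: "isCont f x" "\<bar>f x\<bar> \<le> 1" "0 \<le> f x" "f x = 0 \<longleftrightarrow> \<bar>x\<bar> \<le> 1" for x
      unfolding f_def[abs_def] by (intro continuous_intros) auto
    have "(\<integral>x. f x \<partial>\<mu> n) = 0" for n
      using \<mu>(2)[of n] by (intro integral_eq_zero_AE) (auto simp: f elim!: eventually_mono)
    then have "(\<lambda>n. 0) \<longlonglongrightarrow> (\<integral>x. f x \<partial>M)" using int_lim[of f, OF f(1,2)] by simp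
    then have "(\<integral>x. f x \<partial>M) = 0" using LIMSEQ_unique tendsto_const by blast
    moreover have "integrable M f"
      using f meas[OF M f(1)] by (intro M.integrable_const_bound[where B = 1]) auto
    ultimately have "AE x in M. f x = 0"
      using f(3) by (subst (asm) integral_nonneg_eq_0_iff_AE) auto
    then show ?thesis by (simp add: f)
  qed
  have moments: "(\<integral>x. x ^ m \<partial>M) = c m" for m
  proof -
    define f :: "real \<Rightarrow> real" where "f x = (max (-1) (min 1 x)) ^ m" for x
    have f: "isCont f x" "\<bar>f x\<bar> \<le> 1" for x
      unfolding f_def[abs_def] by (intro continuous_intros) (auto simp: power_abs intro!: power_le_one)
    have eq: "(\<integral>x. f x \<partial>N) = (\<integral>x. x ^ m \<partial>N)" if N: "real_distribution N" "AE x in N. \<bar>x\<bar> \<le> 1" for N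
    proof (rule integral_cong_AE)
      show "f \<in> borel_measurable N" by (rule meas[OF N(1) f(1)])
      show "(\<lambda>x. x ^ m) \<in> borel_measurable N" by (rule meas[OF N(1)]) (intro continuous_intros)
      show "AE x in N. f x = x ^ m"
        using N(2)
      proof eventually_elim
        case (elim x)
        then have "max (-1) (min 1 x) = x" by simp
        then show ?case by (simp add: f_def)
      qed
    qed
    have "(\<lambda>n. \<integral>x. x ^ m \<partial>\<mu> (r n)) \<longlonglongrightarrow> (\<integral>x. x ^ m \<partial>M)"
      using int_lim[of f, OF f] by (simp add: eq \<mu> M supp)
    moreover have "(\<lambda>n. \<integral>x. x ^ m \<partial>\<mu> (r n)) \<longlonglongrightarrow> c m"
      using LIMSEQ_subseq_LIMSEQ[OF lim r] by (simp add: comp_def)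
    ultimately show ?thesis by (rule LIMSEQ_unique)
  qed
  have "weak_conv_m \<mu> M"
  proof (rule levy_continuity[OF \<mu>(1) M])
    show "(\<lambda>n. char (\<mu> n) t) \<longlonglongrightarrow> char M t" for t
      by (rule char_convergence_from_moments[OF \<mu> M supp]) (simp add: moments lim)
  qed
  moreover have "measure M {-1..1} = 1"
    using supp by (subst M.prob_eq_1) (auto elim!: eventually_mono)
  ultimately show thesis using that M moments by blast
qed

section \<open>The recursion for the limiting moments\<close>

text \<open>Coefficients of the differential equation \<open>(exp \<circ> F)' = F' * (exp \<circ> F)\<close>.\<close>
lemma exp_compose_recurrence:
  fixes F :: "real fps"
  assumes "fps_nth F 0 = 0"
  shows "real (Suc m) * fps_nth (fps_exp 1 oo F) (Suc m)
    = (\<Sum>i\<le>m. real (Suc i) * fps_nth F (Suc i) * fps_nth (fps_exp 1 oo F) (m - i))"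
proof -
  have "fps_deriv (fps_exp 1 oo F) = fps_deriv F * (fps_exp 1 oo F)"
    using fps_compose_deriv[OF assms, of "fps_exp 1"] by (simp add: mult.commute)
  then have "fps_nth (fps_deriv (fps_exp 1 oo F)) m = fps_nth (fps_deriv F * (fps_exp 1 oo F)) m" by simp
  then show ?thesis by (simp add: fps_mult_nth atLeast0AtMost del: of_nat_Suc)
qed

text \<open>
  The moment of the limit, up to the quotient \<open>\<Gamma>(\<theta>) / \<Gamma>(\<theta> + m (k - 1))\<close> that results from the Ewens
  normalisation.
\<close>
definition scaled_moment :: "nat \<Rightarrow> real \<Rightarrow> nat \<Rightarrow> real" where
  "scaled_moment k \<theta> m = fact m * fps_nth (fps_exp 1 oo K k \<theta>) m"

lemma scaled_moment_0: "scaled_moment k \<theta> 0 = 1"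
  by (simp add: scaled_moment_def)

text \<open>
  The quotient \<open>2 * fact q / fact (q + 2)\<close>, for even \<open>q\<close>, is the mean of the \<open>q\<close>-th powers of \<open>a\<close>. For odd
  \<open>q\<close> both that mean and the coefficient of \<open>K\<close> vanish.
\<close>
lemma fact_K_nth:
  assumes "k > 1" "q > 0"
  shows "fact q * fps_nth (K k \<theta>) q = \<theta> * fact (q * (k - 1) - 1) * ((1 + (- 1) ^ q) / real ((q + 1) * (q + 2)))"
proof (cases "even q")
  case True
  then obtain r where r: "q = 2 * r" by blast
  have "(fact (q + 2) :: real) = real ((q + 1) * (q + 2)) * fact q"
    by (simp add: algebra_simps)
  then have "fps_nth (K k \<theta>) q = 2 * \<theta> * fact (q * (k - 1) - 1) / (real ((q + 1) * (q + 2)) * fact q)"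
    using True assms by (simp add: K_def kappa_def r)
  then show ?thesis using True by (simp del: of_nat_mult of_nat_add)
next
  case False
  then show ?thesis by (simp add: K_def)
qed

lemma scaled_moment_Suc:
  assumes "k > 1"
  shows "scaled_moment k \<theta> (Suc m) = \<theta> * (\<Sum>i\<le>m. real (m choose i) *
    (fact (Suc i * (k - 1) - 1) * ((1 + (- 1) ^ Suc i) / real ((Suc i + 1) * (Suc i + 2)))
      * scaled_moment k \<theta> (m - i)))"
proof -
  let ?f = "fps_exp 1 oo K k \<theta>"
  have "scaled_moment k \<theta> (Suc m) = fact m * (real (Suc m) * fps_nth ?f (Suc m))"
    by (simp add: scaled_moment_def mult_ac)
  also have "\<dots> = fact m * (\<Sum>i\<le>m. real (Suc i) * fps_nth (K k \<theta>) (Suc i) * fps_nth ?f (m - i))"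
    by (subst exp_compose_recurrence) (simp_all add: K_def)
  also have "\<dots> = (\<Sum>i\<le>m. real (m choose i) * ((fact (Suc i) * fps_nth (K k \<theta>) (Suc i)) * scaled_moment k \<theta> (m - i)))"
    unfolding sum_distrib_left
  proof (intro sum.cong refl)
    fix i assume "i \<in> {..m}"
    then have "(fact m :: real) = real (m choose i) * fact i * fact (m - i)"
      by (simp add: binomial_fact)
    then show "fact m * (real (Suc i) * fps_nth (K k \<theta>) (Suc i) * fps_nth ?f (m - i))
        = real (m choose i) * ((fact (Suc i) * fps_nth (K k \<theta>) (Suc i)) * scaled_moment k \<theta> (m - i))"
      by (simp only: scaled_moment_def fact_Suc mult_ac)
  qed
  also have "\<dots> = \<theta> * (\<Sum>i\<le>m. real (m choose i) *
    (fact (Suc i * (k - 1) - 1) * ((1 + (- 1) ^ Suc i) / real ((Suc i + 1) * (Suc i + 2)))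
      * scaled_moment k \<theta> (m - i)))"
    unfolding sum_distrib_left fact_K_nth[OF assms zero_less_Suc]
    by (intro sum.cong refl) (simp only: mult_ac)
  finally show ?thesis .
qed


section \<open>Asymptotics of the moments under the Ewens weights\<close>

lemma power_equiv_rising_coeff:
  assumes "S \<ge> 1"
  shows "(\<lambda>j. (if j = 0 then 0 else real j ^ (S - 1)) - fact (S - 1) * rising_coeff (real S) j) \<in> o(rising_coeff (real S))"
proof -
  have pos: "rising_coeff (real S) j > 0" for j using assms by (intro rising_coeff_pos) auto
  have "Gamma (real S) = fact (S - 1)"
    using Gamma_fact[of "S - 1", where 'a = real] assms by (simp add: of_nat_diff)
  then have 1: "(\<lambda>j. rising_coeff (real S) j / (real j + 1) powr (real S - 1)) \<longlonglongrightarrow> 1 / fact (S - 1)"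
    using rising_coeff_asymp[of "real S"] assms by simp
  have "(\<lambda>j. real j / (real j + 1)) \<longlonglongrightarrow> 1" by real_asymp
  then have 2: "(\<lambda>j. (real j / (real j + 1)) ^ (S - 1)) \<longlonglongrightarrow> 1 ^ (S - 1)" by (rule tendsto_power)
  have "(\<lambda>j. (real j / (real j + 1)) ^ (S - 1) / (rising_coeff (real S) j / (real j + 1) powr (real S - 1))
      - fact (S - 1)) \<longlonglongrightarrow> 1 ^ (S - 1) / (1 / fact (S - 1)) - fact (S - 1)"
    by (rule tendsto_diff[OF tendsto_divide[OF 2 1] tendsto_const]) simp
  then have lim: "(\<lambda>j. (real j / (real j + 1)) ^ (S - 1) / (rising_coeff (real S) j / (real j + 1) powr (real S - 1))
      - fact (S - 1)) \<longlonglongrightarrow> 0" by simp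
  show ?thesis
  proof (rule smalloI_tendsto)
    show "\<forall>\<^sub>F j in sequentially. rising_coeff (real S) j \<noteq> 0"
      using pos by (simp add: less_imp_neq[symmetric])
    show "(\<lambda>j. ((if j = 0 then 0 else real j ^ (S - 1)) - fact (S - 1) * rising_coeff (real S) j)
        / rising_coeff (real S) j) \<longlonglongrightarrow> 0"
      using lim
    proof (rule Lim_transform_eventually)
      show "\<forall>\<^sub>F j in sequentially. (real j / (real j + 1)) ^ (S - 1) /
          (rising_coeff (real S) j / (real j + 1) powr (real S - 1)) - fact (S - 1) =
          ((if j = 0 then 0 else real j ^ (S - 1)) - fact (S - 1) * rising_coeff (real S) j) / rising_coeff (real S) j"
        using eventually_gt_at_top[of 0]
      proof eventually_elim
        case (elim j)
        have "(real j + 1) powr (real S - 1) = (real j + 1) ^ (S - 1)"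
          using assms by (simp add: powr_realpow[symmetric] of_nat_diff)
        then show ?case
          using elim pos[of j] by (simp add: power_divide diff_divide_distrib)
      qed
    qed
  qed
qed

lemma ewens_sum_binomial:
  "ewens_sum \<theta> g n (\<lambda>x. (y + x) ^ m)
    = (\<Sum>i\<le>m. real (m choose i) * y ^ i * ewens_sum \<theta> g n (\<lambda>x. x ^ (m - i)))"
proof -
  have "perm_sum \<theta> g {1..n} (\<lambda>x. (y + x) ^ m)
    = (\<Sum>\<sigma> | \<sigma> permutes {1..n}. \<Sum>i\<le>m. real (m choose i) * y ^ i *
        (\<theta> ^ card (cycles_on {1..n} \<sigma>) * cycle_sum g {1..n} \<sigma> ^ (m - i)))"
    unfolding perm_sum_def binomial_ring sum_distrib_left
    by (rule sum.cong[OF refl], rule sum.cong[OF refl]) (simp only: mult_ac)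
  also have "\<dots> = (\<Sum>i\<le>m. real (m choose i) * y ^ i * perm_sum \<theta> g {1..n} (\<lambda>x. x ^ (m - i)))"
    unfolding perm_sum_def sum_distrib_left by (rule sum.swap)
  finally show ?thesis by (simp add: ewens_sum_def sum_divide_distrib)
qed

lemma ewens_sum_power_Suc:
  "ewens_sum \<theta> g n (\<lambda>x. x ^ Suc m) = \<theta> * (\<Sum>i\<le>m. real (m choose i) *
     (\<Sum>j\<le>n. (if j = 0 then 0 else g j ^ Suc i / real j) * ewens_sum \<theta> g (n - j) (\<lambda>x. x ^ (m - i))))"
proof -
  have "ewens_sum \<theta> g n (\<lambda>x. x ^ Suc m)
      = \<theta> * (\<Sum>j=1..n. \<Sum>i\<le>m. real (m choose i) *
          (g j ^ Suc i / real j * ewens_sum \<theta> g (n - j) (\<lambda>x. x ^ (m - i))))"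
    unfolding power_Suc ewens_sum_size_bias ewens_sum_binomial sum_distrib_left
    by (rule sum.cong[OF refl], rule sum.cong[OF refl]) (simp add: mult_ac)
  also have "(\<Sum>j=1..n. \<Sum>i\<le>m. real (m choose i) *
          (g j ^ Suc i / real j * ewens_sum \<theta> g (n - j) (\<lambda>x. x ^ (m - i))))
      = (\<Sum>i\<le>m. real (m choose i) * (\<Sum>j=1..n. g j ^ Suc i / real j * ewens_sum \<theta> g (n - j) (\<lambda>x. x ^ (m - i))))"
    unfolding sum_distrib_left by (rule sum.swap)
  also have "\<dots> = (\<Sum>i\<le>m. real (m choose i) *
     (\<Sum>j\<le>n. (if j = 0 then 0 else g j ^ Suc i / real j) * ewens_sum \<theta> g (n - j) (\<lambda>x. x ^ (m - i))))"
    by (intro sum.cong[OF refl] arg_cong2[where f = "(*)"] refl sum.mono_neutral_cong_left) auto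
  finally show ?thesis .
qed

text \<open>
  Induction along the recursion \<open>ewens_sum_power_Suc\<close>. The summand for \<open>i\<close> is the convolution of
  \<open>j ^ (p (i+1) - 1) * a j ^ (i+1)\<close>, a weight of exponent \<open>p (i+1)\<close> times a sequence with a mean, with the
  moment of order \<open>m - i\<close>, of exponent \<open>\<theta> + p (m-i)\<close>. The exponents always add up to
  \<open>\<theta> + p (m+1)\<close>, so all summands are of the same order.
\<close>
theorem ewens_moment_asymptotics:
  fixes a c \<nu> :: "nat \<Rightarrow> real"
  assumes \<theta>: "\<theta> > 0" and p: "p \<ge> 1" and a: "\<And>j. \<bar>a j\<bar> \<le> 1"
    and mean: "\<And>q. q \<ge> 1 \<Longrightarrow> (\<lambda>n. \<Sum>j\<le>n. a j ^ q - \<nu> q) \<in> o(\<lambda>n. real n + 1)"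
    and c0: "c 0 = 1"
    and cSuc: "\<And>m. c (Suc m) = \<theta> * (\<Sum>i\<le>m. real (m choose i) * (fact (Suc i * p - 1) * \<nu> (Suc i) * c (m - i)))"
  shows "(\<lambda>n. ewens_sum \<theta> (\<lambda>j. real j ^ p * a j) n (\<lambda>x. x ^ m) - c m * rising_coeff (\<theta> + real (m * p)) n)
      \<in> o(rising_coeff (\<theta> + real (m * p)))"
proof (induction m rule: less_induct)
  case (less m)
  define g where "g j = real j ^ p * a j" for j
  define A where "A m n = ewens_sum \<theta> g n (\<lambda>x. x ^ m)" for m n
  show ?case
  proof (cases m)
    case 0
    then show ?thesis by (simp add: ewens_sum_total c0)
  next
    case (Suc m')
    define L where "L = \<theta> + real (m * p)"
    define x where "x i j = (if j = 0 then 0 else g j ^ Suc i / real j)" for i j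
    have conv: "(\<lambda>n. (\<Sum>j\<le>n. x i j * A (m' - i) (n - j))
        - fact (Suc i * p - 1) * \<nu> (Suc i) * c (m' - i) * rising_coeff L n) \<in> o(rising_coeff L)"
      if i: "i \<le> m'" for i
    proof -
      define S where "S = Suc i * p"
      define f :: real where "f = fact (S - 1)"
      have S: "S \<ge> 1" using p by (simp add: S_def)
      then have S': "real S \<ge> 1" by simp
      have \<gamma>: "\<theta> + real ((m' - i) * p) > 0" using \<theta> by (intro add_pos_nonneg) auto
      have "m = Suc i + (m' - i)" using Suc i by simp
      then have "m * p = S + (m' - i) * p" unfolding S_def by (metis add_mult_distrib)
      then have L: "real S + (\<theta> + real ((m' - i) * p)) = L" by (simp add: L_def)
      have b: "\<bar>f * a j ^ Suc i\<bar> \<le> f" for j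
        using power_le_one[OF abs_ge_zero a, of j "Suc i"]
        by (simp add: f_def abs_mult power_abs mult_left_le del: power_Suc)
      have "(\<lambda>n. f * (\<Sum>j\<le>n. a j ^ Suc i - \<nu> (Suc i))) \<in> o(\<lambda>n. real n + 1)"
        using mean[of "Suc i"] by (simp add: f_def)
      then have mean': "(\<lambda>n. \<Sum>j\<le>n. f * a j ^ Suc i - f * \<nu> (Suc i)) \<in> o(\<lambda>n. real n + 1)"
        by (simp only: sum_distrib_left right_diff_distrib)
      have xS: "x i j - f * a j ^ Suc i * rising_coeff (real S) j
          = a j ^ Suc i * ((if j = 0 then 0 else real j ^ (S - 1)) - f * rising_coeff (real S) j)" for j
      proof (cases "j = 0")
        case False
        have "g j ^ Suc i = real j ^ S * a j ^ Suc i"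
          by (simp only: g_def power_mult_distrib S_def power_mult[symmetric] mult.commute)
        also have "real j ^ S = real j ^ (S - 1) * real j"
          using S by (metis Suc_diff_1 power_Suc2 less_eq_Suc_le One_nat_def)
        finally have "x i j = real j ^ (S - 1) * a j ^ Suc i"
          using False by (simp add: x_def del: power_Suc)
        then show ?thesis using False by (simp add: algebra_simps del: power_Suc)
      qed (simp add: x_def)
      have "(\<lambda>j. a j ^ Suc i * ((if j = 0 then 0 else real j ^ (S - 1)) - f * rising_coeff (real S) j))
          \<in> o(\<lambda>j. 1 * rising_coeff (real S) j)"
      proof (rule landau_o.big_small_mult)
        show "(\<lambda>j. a j ^ Suc i) \<in> O(\<lambda>_. 1)"
          using power_le_one[OF abs_ge_zero a] by (intro bigoI[where c = 1]) (auto simp: power_abs simp del: power_Suc)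
        show "(\<lambda>j. (if j = 0 then 0 else real j ^ (S - 1)) - f * rising_coeff (real S) j) \<in> o(rising_coeff (real S))"
          unfolding f_def by (rule power_equiv_rising_coeff[OF S])
      qed
      then have x: "(\<lambda>j. x i j - f * a j ^ Suc i * rising_coeff (real S) j) \<in> o(rising_coeff (real S))"
        unfolding xS by simp
      have y: "(\<lambda>n. A (m' - i) n - c (m' - i) * rising_coeff (\<theta> + real ((m' - i) * p)) n)
          \<in> o(rising_coeff (\<theta> + real ((m' - i) * p)))"
        using less.IH[of "m' - i"] Suc by (simp add: A_def g_def[abs_def])
      show ?thesis
        using cesaro_convolution[OF S' \<gamma> b mean' x y] unfolding L unfolding f_def S_def .
    qed
    have "ewens_sum \<theta> g n (\<lambda>x. x ^ m) - c m * rising_coeff L n = (\<Sum>i\<le>m'. \<theta> * real (m' choose i) *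
        ((\<Sum>j\<le>n. x i j * A (m' - i) (n - j))
        - fact (Suc i * p - 1) * \<nu> (Suc i) * c (m' - i) * rising_coeff L n))" for n
      unfolding Suc ewens_sum_power_Suc cSuc x_def A_def
      by (simp only: sum_distrib_left sum_distrib_right right_diff_distrib sum_subtractf mult.assoc)
    moreover have "(\<lambda>n. \<Sum>i\<le>m'. \<theta> * real (m' choose i) *
        ((\<Sum>j\<le>n. x i j * A (m' - i) (n - j))
        - fact (Suc i * p - 1) * \<nu> (Suc i) * c (m' - i) * rising_coeff L n)) \<in> o(rising_coeff L)"
      using \<theta> conv by (intro big_sum_in_smallo) (auto simp: landau_o.small.cmult_in_iff)
    ultimately show ?thesis by (simp add: L_def g_def[abs_def])
  qed
qed

lemma rising_coeff_ratio:
  assumes "\<theta> > 0"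
  shows "(\<lambda>n. rising_coeff (\<theta> + real d) n / (rising_coeff \<theta> n * real n ^ d)) \<longlonglongrightarrow> Gamma \<theta> / Gamma (\<theta> + real d)"
proof -
  have pos: "\<theta> + real d > 0" using assms by simp
  have "(\<lambda>n. (real n + 1) / real n) \<longlonglongrightarrow> 1" by real_asymp
  then have pow: "(\<lambda>n. ((real n + 1) / real n) ^ d) \<longlonglongrightarrow> 1 ^ d" by (rule tendsto_power)
  have "(\<lambda>n. rising_coeff (\<theta> + real d) n / (real n + 1) powr (\<theta> + real d - 1)
      / (rising_coeff \<theta> n / (real n + 1) powr (\<theta> - 1)) * ((real n + 1) / real n) ^ d)
      \<longlonglongrightarrow> 1 / Gamma (\<theta> + real d) / (1 / Gamma \<theta>) * 1 ^ d"
    by (rule tendsto_mult[OF tendsto_divide[OF rising_coeff_asymp[OF pos] rising_coeff_asymp[OF assms]] pow])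
      (use Gamma_real_pos[OF assms] in simp)
  then have "(\<lambda>n. rising_coeff (\<theta> + real d) n / (real n + 1) powr (\<theta> + real d - 1)
      / (rising_coeff \<theta> n / (real n + 1) powr (\<theta> - 1)) * ((real n + 1) / real n) ^ d)
      \<longlonglongrightarrow> Gamma \<theta> / Gamma (\<theta> + real d)" by simp
  then show ?thesis
  proof (rule Lim_transform_eventually)
    show "\<forall>\<^sub>F n in sequentially. rising_coeff (\<theta> + real d) n / (real n + 1) powr (\<theta> + real d - 1)
      / (rising_coeff \<theta> n / (real n + 1) powr (\<theta> - 1)) * ((real n + 1) / real n) ^ d
      = rising_coeff (\<theta> + real d) n / (rising_coeff \<theta> n * real n ^ d)"
      using eventually_gt_at_top[of 0]
    proof eventually_elim
      case (elim n)
      have "\<theta> + real d - 1 = (\<theta> - 1) + real d" by simp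
      then have "(real n + 1) powr (\<theta> + real d - 1) = (real n + 1) powr (\<theta> - 1) * (real n + 1) ^ d"
        by (simp only: powr_add) (simp add: powr_realpow)
      then show ?case
        using elim rising_coeff_pos[OF assms, of n] by (simp add: power_divide)
    qed
  qed
qed

section \<open>Convergence of the normalised cycle statistic\<close>

lemma perm_cycles_eq: "perm_cycles n \<sigma> = cycles_on {1..n} \<sigma>"
  by (simp add: perm_cycles_def cycles_on_def)

lemma card_cycle_bounds:
  assumes "finite A" "\<sigma> permutes A" "c \<in> cycles_on A \<sigma>"
  shows "1 \<le> card c" "card c \<le> card A"
  using cycles_on_subset[OF assms(2,3)] cycles_on_nonempty[OF assms(3)] assms(1)
  by (auto simp: Suc_le_eq card_gt_0_iff finite_subset intro: card_mono)

lemma Y_eq_cycle_sum: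
  assumes "\<sigma> permutes {1..n}"
  shows "Y k \<alpha> \<beta> n \<sigma>
    = cycle_sum (\<lambda>j. real j ^ (k - 1) * (frac (real j * \<alpha>) - frac (real j * \<beta>))) {1..n} \<sigma> / real n ^ (k - 1)"
proof -
  define g where "g j = real j ^ (k - 1) * (frac (real j * \<alpha>) - frac (real j * \<beta>))" for j
  have "cycle_sum g {1..n} \<sigma> = (\<Sum>j=1..n. \<Sum>c | c \<in> cycles_on {1..n} \<sigma> \<and> card c = j. g (card c))"
    unfolding cycle_sum_def using card_cycle_bounds[OF _ assms]
    by (intro sum.group[symmetric]) (auto simp: finite_cycles_on)
  also have "\<dots> = (\<Sum>j=1..n. real (num_cycles_of_length n j \<sigma>) * g j)"
    by (intro sum.cong refl) (simp add: num_cycles_of_length_def perm_cycles_eq)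
  finally show ?thesis
    by (simp add: Y_def g_def[abs_def] sum_divide_distrib mult_ac)
qed

text \<open>
  Of the \<open>k - 1\<close> powers of a cycle length, all but one are bounded by powers of \<open>n\<close>. The remaining one
  sums to \<open>n\<close>.
\<close>
lemma abs_Y_le_1:
  assumes "k > 1" "\<sigma> permutes {1..n}"
  shows "\<bar>Y k \<alpha> \<beta> n \<sigma>\<bar> \<le> 1"
proof -
  let ?a = "\<lambda>j. frac (real j * \<alpha>) - frac (real j * \<beta>)"
  have a: "\<bar>?a j\<bar> \<le> 1" for j
    by (rule abs_frac_diff_le_1)
  obtain p where p: "k - 1 = Suc p" using assms(1) by (cases "k - 1") auto
  have "\<bar>cycle_sum (\<lambda>j. real j ^ (k - 1) * ?a j) {1..n} \<sigma>\<bar>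
      \<le> (\<Sum>c\<in>cycles_on {1..n} \<sigma>. real n ^ p * real (card c))"
    unfolding cycle_sum_def
  proof (rule order_trans[OF sum_abs sum_mono])
    fix c assume "c \<in> cycles_on {1..n} \<sigma>"
    from card_cycle_bounds(2)[OF _ assms(2) this] have "card c \<le> n" by simp
    have "\<bar>real (card c) ^ (k - 1) * ?a (card c)\<bar> = real (card c) ^ (k - 1) * \<bar>?a (card c)\<bar>"
      by (simp only: abs_mult power_abs abs_of_nat)
    also have "\<dots> \<le> real (card c) ^ (k - 1) * 1"
      by (intro mult_left_mono a) auto
    also have "\<dots> = real (card c) ^ p * real (card c)" by (simp only: p power_Suc2 mult_1_right)
    also have "\<dots> \<le> real n ^ p * real (card c)"
      using \<open>card c \<le> n\<close> by (intro mult_right_mono power_mono) auto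
    finally show "\<bar>real (card c) ^ (k - 1) * ?a (card c)\<bar> \<le> real n ^ p * real (card c)" .
  qed
  also have "\<dots> = real n ^ p * cycle_sum real {1..n} \<sigma>" by (simp add: cycle_sum_def sum_distrib_left)
  also have "\<dots> = real n ^ (k - 1)" 
    unfolding p power_Suc2 using sum_card_cycles_on[OF _ assms(2)] by simp
  finally show ?thesis
    unfolding Y_eq_cycle_sum[OF assms(2)] using assms(1) by (auto simp add: divide_le_eq_1)
qed

lemma ewens_expectation:
  assumes "\<theta> > 0"
  shows "(\<integral>\<sigma>. f \<sigma> \<partial>ewens \<theta> n) = (\<Sum>\<sigma> | \<sigma> permutes {1..n}. \<theta> ^ card (cycles_on {1..n} \<sigma>) * f \<sigma>) / pochhammer \<theta> n"
proof -
  have "(\<integral>\<sigma>. f \<sigma> \<partial>ewens \<theta> n)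
      = (\<Sum>\<sigma> | \<sigma> permutes {1..n}. (\<theta> ^ num_cycles n \<sigma> / pochhammer \<theta> n) * f \<sigma>)"
    unfolding ewens_def using assms pochhammer_pos[OF assms, of n]
    by (subst lebesgue_integral_point_measure_finite) (auto simp: finite_permutations)
  then show ?thesis by (simp add: num_cycles_def perm_cycles_eq sum_divide_distrib)
qed

lemma prob_space_ewens:
  assumes "\<theta> > 0"
  shows "prob_space (ewens \<theta> n)"
proof (rule prob_spaceI)
  let ?P = "{\<sigma>. \<sigma> permutes {1..n}}"
  have pos: "pochhammer \<theta> n > 0" by (rule pochhammer_pos[OF assms])
  have "emeasure (ewens \<theta> n) (space (ewens \<theta> n)) = (\<Sum>\<sigma>\<in>?P. ennreal (\<theta> ^ num_cycles n \<sigma> / pochhammer \<theta> n))"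
    unfolding ewens_def by (simp add: space_point_measure emeasure_point_measure_finite finite_permutations)
  also have "\<dots> = ennreal (\<Sum>\<sigma>\<in>?P. \<theta> ^ num_cycles n \<sigma> / pochhammer \<theta> n)"
    using assms pos by (intro sum_ennreal) auto
  also have "(\<Sum>\<sigma>\<in>?P. \<theta> ^ num_cycles n \<sigma> / pochhammer \<theta> n) = 1"
    using ewens_sum_total[of \<theta> real n] pos
    by (simp add: ewens_sum_def perm_sum_def rising_coeff_def num_cycles_def perm_cycles_eq
        flip: sum_divide_distrib)
  finally show "emeasure (ewens \<theta> n) (space (ewens \<theta> n)) = 1" by simp
qed

lemma rat_independentD:
  assumes "rat_independent {1, \<alpha>, \<beta>}" "\<alpha> \<notin> \<rat>" "\<beta> \<notin> \<rat>" "\<alpha> \<noteq> \<beta>"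
    and "of_int a * \<alpha> + of_int b * \<beta> \<in> \<int>"
  shows "a = 0 \<and> b = 0"
proof -
  interpret rat: module "\<lambda>(q::rat) (x::real). of_rat q * x"
    by unfold_locales (simp_all add: algebra_simps of_rat_add of_rat_mult)
  have ne: "1 \<noteq> \<alpha>" "1 \<noteq> \<beta>" using assms(2,3) Rats_1 by auto
  obtain m where m: "of_int a * \<alpha> + of_int b * \<beta> = of_int m" using assms(5) by (auto elim: Ints_cases)
  define u :: "real \<Rightarrow> rat" where "u v = (if v = 1 then - of_int m else if v = \<alpha> then of_int a else of_int b)" for v
  have "(\<Sum>v\<in>{1, \<alpha>, \<beta>}. of_rat (u v) * v) = 0"
    using ne assms(4) m by (simp add: u_def of_rat_minus)
  then have "u v = 0" if "v \<in> {1, \<alpha>, \<beta>}" for v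
    using assms(1) that unfolding rat_independent_def
    by (intro rat.independentD[of "{1, \<alpha>, \<beta>}" "{1, \<alpha>, \<beta>}"]) auto
  from this[of \<alpha>] this[of \<beta>] show ?thesis using ne assms(4) by (simp add: u_def)
qed

theorem theorem1p2:
  fixes k :: nat and \<theta> \<alpha> \<beta> :: real
  assumes "k > 1"
    and "\<theta> > 0"
    and "\<alpha> < \<beta>"
    and "\<alpha> \<notin> \<rat>" and "\<beta> \<notin> \<rat>"
    and "rat_independent {1, \<alpha>, \<beta>}"
  shows "\<exists>Y_inf :: real measure.
           real_distribution Y_inf \<and>
           (\<exists>S. compact S \<and> measure Y_inf S = 1) \<and>
           weak_conv_m (\<lambda>n. distr (ewens \<theta> n) borel (Y k \<alpha> \<beta> n)) Y_inf \<and>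
           Abs_fps (\<lambda>m. (\<integral>y. y ^ m \<partial>Y_inf) *
               (Gamma (real (m * (k - 1)) + \<theta>) / (Gamma \<theta> * fact m)))
             = fps_exp 1 oo K k \<theta>"
proof -
  define p where "p = k - 1"
  define a where "a j = frac (real j * \<alpha>) - frac (real j * \<beta>)" for j
  define g where "g j = real j ^ p * a j" for j
  define \<nu> where "\<nu> q = (1 + (- 1) ^ q) / real ((q + 1) * (q + 2))" for q
  have p: "p \<ge> 1" using assms(1) by (simp add: p_def)
  have a_bound: "\<bar>a j\<bar> \<le> 1" for j
    unfolding a_def
    by (rule abs_frac_diff_le_1)
  interpret torus_rotation \<alpha> \<beta>
    using rat_independentD[OF assms(6,4,5)] assms(3) by unfold_locales auto
  (* averages run over j < N, convolutions over j \<le> n, hence N = Suc n *)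
  have mean: "(\<lambda>n. \<Sum>j\<le>n. a j ^ q - \<nu> q) \<in> o(\<lambda>n. real n + 1)" for q
  proof (rule smalloI_tendsto)
    have "(\<lambda>n. average (\<lambda>p. (frac (fst p) - frac (snd p)) ^ q) (Suc n) - \<nu> q) \<longlonglongrightarrow> \<nu> q - \<nu> q"
      using LIMSEQ_Suc[OF average_frac_diff_power[of q]] unfolding \<nu>_def by (intro tendsto_intros)
    also have "(\<lambda>n. average (\<lambda>p. (frac (fst p) - frac (snd p)) ^ q) (Suc n) - \<nu> q)
        = (\<lambda>n. (\<Sum>j\<le>n. a j ^ q - \<nu> q) / (real n + 1))"
    proof
      fix n
      have "average (\<lambda>p. (frac (fst p) - frac (snd p)) ^ q) (Suc n) = (\<Sum>j\<le>n. a j ^ q) / (real n + 1)"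
        by (simp add: average_def a_def lessThan_Suc_atMost divide_inverse mult.commute add.commute)
      then show "average (\<lambda>p. (frac (fst p) - frac (snd p)) ^ q) (Suc n) - \<nu> q
          = (\<Sum>j\<le>n. a j ^ q - \<nu> q) / (real n + 1)"
        by (simp add: sum_subtractf field_simps)
    qed
    finally show "(\<lambda>n. (\<Sum>j\<le>n. a j ^ q - \<nu> q) / (real n + 1)) \<longlonglongrightarrow> 0" by simp
  qed (simp add: eventually_sequentially add_eq_0_iff)
  define c where "c = scaled_moment k \<theta>"
  have c0: "c 0 = 1" by (simp add: c_def scaled_moment_0)
  have cSuc: "c (Suc m) = \<theta> * (\<Sum>i\<le>m. real (m choose i) * (fact (Suc i * p - 1) * \<nu> (Suc i) * c (m - i)))" for m
    unfolding c_def p_def \<nu>_def by (rule scaled_moment_Suc[OF assms(1)])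
  define \<mu> where "\<mu> n = distr (ewens \<theta> n) borel (Y k \<alpha> \<beta> n)" for n
  have Ymeas: "Y k \<alpha> \<beta> n \<in> borel_measurable (ewens \<theta> n)" for n
    unfolding ewens_def by (simp add: measurable_point_measure_eq1)
  have \<mu>_dist: "real_distribution (\<mu> n)" for n
    unfolding \<mu>_def by (rule prob_space.real_distribution_distr[OF prob_space_ewens[OF assms(2)] Ymeas])
  have \<mu>_supp: "AE x in \<mu> n. \<bar>x\<bar> \<le> 1" for n
    unfolding \<mu>_def using abs_Y_le_1[OF assms(1)]
    by (subst AE_distr_iff[OF Ymeas]) (auto intro!: AE_I2 simp: ewens_def space_point_measure)
  have moment: "(\<integral>x. x ^ m \<partial>\<mu> n) = ewens_sum \<theta> g n (\<lambda>x. x ^ m) / (rising_coeff \<theta> n * real n ^ (m * p))" for m n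
  proof -
    have "(\<integral>x. x ^ m \<partial>\<mu> n) = (\<integral>\<sigma>. Y k \<alpha> \<beta> n \<sigma> ^ m \<partial>ewens \<theta> n)"
      unfolding \<mu>_def by (intro integral_distr Ymeas) simp
    also have "\<dots> = (\<Sum>\<sigma> | \<sigma> permutes {1..n}. \<theta> ^ card (cycles_on {1..n} \<sigma>) * Y k \<alpha> \<beta> n \<sigma> ^ m) / pochhammer \<theta> n"
      by (rule ewens_expectation[OF assms(2)])
    also have "(\<Sum>\<sigma> | \<sigma> permutes {1..n}. \<theta> ^ card (cycles_on {1..n} \<sigma>) * Y k \<alpha> \<beta> n \<sigma> ^ m)
        = perm_sum \<theta> g {1..n} (\<lambda>x. x ^ m) / real n ^ (m * p)"
      unfolding perm_sum_def sum_divide_distrib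
    proof (rule sum.cong[OF refl])
      fix \<sigma> assume "\<sigma> \<in> {\<sigma>. \<sigma> permutes {1..n}}"
      then have "Y k \<alpha> \<beta> n \<sigma> = cycle_sum g {1..n} \<sigma> / real n ^ p"
        using Y_eq_cycle_sum by (simp add: g_def[abs_def] a_def p_def)
      then show "\<theta> ^ card (cycles_on {1..n} \<sigma>) * Y k \<alpha> \<beta> n \<sigma> ^ m
          = \<theta> ^ card (cycles_on {1..n} \<sigma>) * cycle_sum g {1..n} \<sigma> ^ m / real n ^ (m * p)"
        by (simp add: power_divide power_mult[symmetric] mult.commute)
    qed
    finally show ?thesis by (simp add: ewens_sum_def rising_coeff_def)
  qed
  have lim: "(\<lambda>n. \<integral>x. x ^ m \<partial>\<mu> n) \<longlonglongrightarrow> c m * (Gamma \<theta> / Gamma (\<theta> + real (m * p)))" for m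
  proof -
    let ?R = "rising_coeff (\<theta> + real (m * p))"
    have Rpos: "?R n > 0" for n using assms(2) by (intro rising_coeff_pos add_pos_nonneg) auto
    have "(\<lambda>n. ewens_sum \<theta> g n (\<lambda>x. x ^ m) - c m * ?R n) \<in> o(?R)"
      unfolding g_def by (rule ewens_moment_asymptotics[OF assms(2) p a_bound mean c0 cSuc])
    then have "(\<lambda>n. (ewens_sum \<theta> g n (\<lambda>x. x ^ m) - c m * ?R n) / ?R n) \<longlonglongrightarrow> 0"
      by (rule smalloD_tendsto)
    then have "(\<lambda>n. (ewens_sum \<theta> g n (\<lambda>x. x ^ m) - c m * ?R n) / ?R n + c m) \<longlonglongrightarrow> 0 + c m"
      by (intro tendsto_intros)
    also have "(\<lambda>n. (ewens_sum \<theta> g n (\<lambda>x. x ^ m) - c m * ?R n) / ?R n + c m)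
        = (\<lambda>n. ewens_sum \<theta> g n (\<lambda>x. x ^ m) / ?R n)"
      using Rpos by (simp add: fun_eq_iff diff_divide_distrib less_imp_neq[symmetric])
    finally have 1: "(\<lambda>n. ewens_sum \<theta> g n (\<lambda>x. x ^ m) / ?R n) \<longlonglongrightarrow> c m" by simp
    have "(\<lambda>n. ewens_sum \<theta> g n (\<lambda>x. x ^ m) / ?R n * (?R n / (rising_coeff \<theta> n * real n ^ (m * p))))
        \<longlonglongrightarrow> c m * (Gamma \<theta> / Gamma (\<theta> + real (m * p)))"
      by (intro tendsto_mult 1 rising_coeff_ratio assms)
    also have "(\<lambda>n. ewens_sum \<theta> g n (\<lambda>x. x ^ m) / ?R n * (?R n / (rising_coeff \<theta> n * real n ^ (m * p))))
        = (\<lambda>n. \<integral>x. x ^ m \<partial>\<mu> n)"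
      using Rpos by (simp add: fun_eq_iff moment less_imp_neq[symmetric])
    finally show ?thesis .
  qed
  obtain M where M: "real_distribution M" "measure M {-1..1} = 1" "weak_conv_m \<mu> M"
    "\<And>m. (\<integral>x. x ^ m \<partial>M) = c m * (Gamma \<theta> / Gamma (\<theta> + real (m * p)))"
    by (rule method_of_moments_bounded[OF \<mu>_dist \<mu>_supp lim]) blast
  show ?thesis
  proof (intro exI[of _ M] conjI M(1))
    show "\<exists>S. compact S \<and> measure M S = 1" using M(2) by (intro exI[of _ "{-1..1}"]) simp
    show "weak_conv_m (\<lambda>n. distr (ewens \<theta> n) borel (Y k \<alpha> \<beta> n)) M" using M(3) by (simp add: \<mu>_def[abs_def])
    show "Abs_fps (\<lambda>m. (\<integral>y. y ^ m \<partial>M) * (Gamma (real (m * (k - 1)) + \<theta>) / (Gamma \<theta> * fact m)))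
        = fps_exp 1 oo K k \<theta>"
    proof (rule fps_ext)
      fix m
      have "Gamma \<theta> > 0" "Gamma (\<theta> + real (m * p)) > 0"
        using assms(2) by (auto intro!: Gamma_real_pos add_pos_nonneg)
      then show "fps_nth (Abs_fps (\<lambda>m. (\<integral>y. y ^ m \<partial>M) * (Gamma (real (m * (k - 1)) + \<theta>) / (Gamma \<theta> * fact m)))) m
          = fps_nth (fps_exp 1 oo K k \<theta>) m"
        unfolding p_def[symmetric] by (simp add: M(4) c_def scaled_moment_def add.commute del: of_nat_mult)
    qed
  qed
qed

end
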